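(* (i) Let $\bar{\mathbf{G}}$ be an $n$-dimensional Hamel spray associated to $(\mathbf{G},Q)$. Then $\bar{\mathbf{G}}$ is of scalar curvature if and only if its Riemann curvature has the form $$\bar R^i_{\ k}=\lambda\,(Q^2\delta^i_k-QQ_{.k}y^i),\qquad ( * )$$ where $\lambda=\lambda(x,y)$ is a scalar function given by $$\lambda:=\frac{R+P^2-P_{;0}}{Q^2},\qquad P:=\frac{Q_{;0}}{2Q},\quad R:=\frac{Ric}{n-1},$$ with $Ric$ the Ricci curvature of $\mathbf{G}$ and ";" the horizontal derivative with respect to $\mathbf{G}$. (ii) Let $\bar{\mathbf{G}}$ be a Funk spray associated to $(\mathbf{G},Q)$. Then $\bar{\mathbf{G}}$ is of isotropic curvature if and only if its Riemann curvature has the form $( * )$ with $\lambda=\lambda(x)$ (depending on $x$ only) being given by $$\lambda=\eta-\frac14,\qquad \eta:=\frac{R}{Q^2},\quad R:=\frac{Ric}{n-1}.$$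
   Context: A conical region of $TM\setminus\{0\}$ is an open set closed under $y\mapsto\lambda y$, $\lambda>0$. A spray on an $n$-dimensional manifold $M$ is a smooth vector field on a conical region, locally $\mathbf{G}=y^i\frac{\partial}{\partial x^i}-2G^i\frac{\partial}{\partial y^i}$ with $G^i$ positively homogeneous of degree two in $y$. Put $\partial_k=\partial/\partial x^k$, $\dot\partial_k=\partial/\partial y^k$, $G^r_i=\dot\partial_iG^r$, $G^r_{ij}=\dot\partial_j\dot\partial_iG^r$, $\delta_i=\partial_i-G^r_i\dot\partial_r$. For a function $f$: $f_{.i}=\dot\partial_if$, $f_{;i}=\delta_if$, $f_{;0}=f_{;i}y^i$, $f_{.i;j}=\delta_jf_{.i}-f_{.r}G^r_{ij}$, $f_{.i;0}=f_{.i;j}y^j$. Riemann curvature of a spray: $R^i_{\ k}=2\partial_kG^i-y^j\partial_j\dot\partial_kG^i+2G^j\dot\partial_j\dot\partial_kG^i-(\dot\partial_jG^i)(\dot\partial_kG^j)$; Ricci curvature $Ric=R^i_{\ i}$. The spray is of scalar curvature if $R^i_{\ k}=R\delta^i_k-\tau_ky^i$ for some homogeneous functions $R(x,y),\tau_k(x,y)$; of isotropic curvature if moreover $R_{.i}=2\tau_i$. A Hamel function (resp. Funk function) of a spray $\mathbf{G}$ is a function $Q$, positively homogeneous of degree one in $y$, with $Q_{;k}=Q_{.k;0}$ (resp. $Q_{;k}=QQ_{.k}$). For a spray $\mathbf{G}$ and a nonzero Hamel function $Q$ of $\mathbf{G}$, the Hamel spray associated to $(\mathbf{G},Q)$ is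 $\bar G^i:=G^i+\frac{Q_{;0}}{2Q}y^i$. If $Q$ is a Funk function of $\mathbf{G}$ (hence also a Hamel function), this spray is called the Funk spray associated to $(\mathbf{G},Q)$.
   Formalization: In (ii), "λ=λ(x)" is read as: λ is constant on each connected component of every fibre of the conical region; with disconnected fibres an isotropic Funk spray can have different values of λ over the same x, and with connected fibres this is the literal condition. *)

theory Defs
  imports "HOL-Analysis.Analysis"
begin

section \<open>Smooth maps and smooth manifolds\<close>

text \<open>\<open>C\<^sup>m\<close> on an open set, by iterated directional derivatives.\<close>

primrec Ck_on :: "nat \<Rightarrow> 'a::euclidean_space set \<Rightarrow> ('a \<Rightarrow> 'b::euclidean_space) \<Rightarrow> bool" where
  "Ck_on 0 S f \<longleftrightarrow> continuous_on S f"
| "Ck_on (Suc m) S f \<longleftrightarrow>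
     (\<forall>x\<in>S. f differentiable (at x)) \<and>
     (\<forall>v. Ck_on m S (\<lambda>x. frechet_derivative f (at x) v))"

definition smooth_on :: "'a::euclidean_space set \<Rightarrow> ('a \<Rightarrow> 'b::euclidean_space) \<Rightarrow> bool" where
  "smooth_on S f \<longleftrightarrow> (\<forall>m. Ck_on m S f)"

type_synonym ('m, 'n) chart = "'m set \<times> ('m \<Rightarrow> real ^ 'n)"

definition transition :: "('m, 'n::finite) chart \<Rightarrow> ('m, 'n) chart \<Rightarrow> real ^ 'n \<Rightarrow> real ^ 'n" where
  "transition c d = snd d \<circ> inv_into (fst c) (snd c)"

definition overlap :: "('m, 'n::finite) chart \<Rightarrow> ('m, 'n) chart \<Rightarrow> (real ^ 'n) set" where
  "overlap c d = snd c ` (fst c \<inter> fst d)"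

text \<open>The manifold \<open>M\<close> is the union of the chart domains. The atlas need not be maximal.\<close>

definition smooth_atlas ::
    "('m::{t2_space, second_countable_topology}, 'n::finite) chart set \<Rightarrow> bool" where
  "smooth_atlas A \<longleftrightarrow>
     (\<forall>c\<in>A. open (fst c) \<and> open (snd c ` fst c) \<and>
        (\<exists>\<psi>. homeomorphism (fst c) (snd c ` fst c) (snd c) \<psi>)) \<and>
     (\<forall>c\<in>A. \<forall>d\<in>A. smooth_on (overlap c d) (transition c d))"

section \<open>Conical regions, functions and sprays\<close>

text \<open>
  Objects on (subsets of) \<open>TM\<close> are given by their local representatives: for every chart \<open>c\<close> of
  the atlas, a set or function in the induced coordinates \<open>(x, y)\<close> of \<open>TM\<close>, compatible with
  the coordinate change \<open>tangent_transition c d\<close> of \<open>TM\<close>.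
\<close>

type_synonym 'n xy = "(real ^ 'n) \<times> (real ^ 'n)"

definition tangent_transition ::
    "('m, 'n::finite) chart \<Rightarrow> ('m, 'n) chart \<Rightarrow> 'n xy \<Rightarrow> 'n xy" where
  "tangent_transition c d z =
     (transition c d (fst z), frechet_derivative (transition c d) (at (fst z)) (snd z))"

definition conical_region ::
    "('m, 'n::finite) chart set \<Rightarrow> (('m, 'n) chart \<Rightarrow> 'n xy set) \<Rightarrow> bool" where
  "conical_region A D \<longleftrightarrow>
     (\<forall>c\<in>A. open (D c) \<and> D c \<subseteq> (snd c ` fst c) \<times> (- {0}) \<and>
        (\<forall>(x, y)\<in>D c. \<forall>t>0. (x, t *\<^sub>R y) \<in> D c)) \<and>
     (\<forall>c\<in>A. \<forall>d\<in>A. \<forall>x\<in>overlap c d. \<forall>y.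
        (x, y) \<in> D c \<longleftrightarrow> tangent_transition c d (x, y) \<in> D d)"

definition pos_homogeneous ::
    "nat \<Rightarrow> 'n::finite xy set \<Rightarrow> ('n xy \<Rightarrow> 'b::real_vector) \<Rightarrow> bool" where
  "pos_homogeneous r S f \<longleftrightarrow>
     (\<forall>(x, y)\<in>S. \<forall>t>0. f (x, t *\<^sub>R y) = t ^ r *\<^sub>R f (x, y))"

definition smooth_function ::
    "('m, 'n::finite) chart set \<Rightarrow> (('m, 'n) chart \<Rightarrow> 'n xy set) \<Rightarrow>
     (('m, 'n) chart \<Rightarrow> 'n xy \<Rightarrow> real) \<Rightarrow> bool" where
  "smooth_function A D f \<longleftrightarrow>
     (\<forall>c\<in>A. smooth_on (D c) (f c)) \<and>
     (\<forall>c\<in>A. \<forall>d\<in>A. \<forall>z\<in>D c. fst z \<in> overlap c d \<longrightarrow>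
        f d (tangent_transition c d z) = f c z)"

text \<open>
  The components of the vector field \<open>y\<^sup>i \<partial>/\<partial>x\<^sup>i - 2 G\<^sup>i \<partial>/\<partial>y\<^sup>i\<close>.
\<close>

definition spray_field :: "('n::finite xy \<Rightarrow> real ^ 'n) \<Rightarrow> 'n xy \<Rightarrow> 'n xy" where
  "spray_field G z = (snd z, - 2 *\<^sub>R G z)"

text \<open>
  A spray is given by its coefficients \<open>G c\<close> in the charts \<open>c\<close>. The last condition says that
  the local vector fields are related by the push-forward under the coordinate changes of \<open>TM\<close>.
\<close>

definition spray ::
    "('m, 'n::finite) chart set \<Rightarrow> (('m, 'n) chart \<Rightarrow> 'n xy set) \<Rightarrow>
     (('m, 'n) chart \<Rightarrow> 'n xy \<Rightarrow> real ^ 'n) \<Rightarrow> bool" where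
  "spray A D G \<longleftrightarrow>
     (\<forall>c\<in>A. smooth_on (D c) (G c) \<and> pos_homogeneous 2 (D c) (G c)) \<and>
     (\<forall>c\<in>A. \<forall>d\<in>A. \<forall>z\<in>D c. fst z \<in> overlap c d \<longrightarrow>
        spray_field (G d) (tangent_transition c d z) =
        frechet_derivative (tangent_transition c d) (at z) (spray_field (G c) z))"

section \<open>Derivatives in a chart\<close>

definition dx :: "'n::finite \<Rightarrow> ('n xy \<Rightarrow> real) \<Rightarrow> 'n xy \<Rightarrow> real" where
  "dx k f z = frechet_derivative f (at z) (axis k 1, 0)"

definition dy :: "'n::finite \<Rightarrow> ('n xy \<Rightarrow> real) \<Rightarrow> 'n xy \<Rightarrow> real" where
  "dy k f z = frechet_derivative f (at z) (0, axis k 1)"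

definition comp :: "('n::finite xy \<Rightarrow> real ^ 'n) \<Rightarrow> 'n \<Rightarrow> 'n xy \<Rightarrow> real" where
  "comp G i z = G z $ i"

text \<open>\<open>spray_conn G r i\<close> is \<open>G\<^sup>r\<^sub>i\<close> and \<open>berwald_conn G r i j\<close> is \<open>G\<^sup>r\<^sub>i\<^sub>j\<close>.\<close>

definition spray_conn :: "('n::finite xy \<Rightarrow> real ^ 'n) \<Rightarrow> 'n \<Rightarrow> 'n \<Rightarrow> 'n xy \<Rightarrow> real" where
  "spray_conn G r i = dy i (comp G r)"

definition berwald_conn ::
    "('n::finite xy \<Rightarrow> real ^ 'n) \<Rightarrow> 'n \<Rightarrow> 'n \<Rightarrow> 'n \<Rightarrow> 'n xy \<Rightarrow> real" where
  "berwald_conn G r i j = dy j (dy i (comp G r))"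

text \<open>\<open>hd_cov G i f\<close> is \<open>f\<^sub>;\<^sub>i = \<delta>\<^sub>i f\<close> and \<open>hd0 G f\<close> is \<open>f\<^sub>;\<^sub>0\<close>.\<close>

definition hd_cov :: "('n::finite xy \<Rightarrow> real ^ 'n) \<Rightarrow> 'n \<Rightarrow> ('n xy \<Rightarrow> real) \<Rightarrow> 'n xy \<Rightarrow> real" where
  "hd_cov G i f z = dx i f z - (\<Sum>r\<in>UNIV. spray_conn G r i z * dy r f z)"

definition hd0 :: "('n::finite xy \<Rightarrow> real ^ 'n) \<Rightarrow> ('n xy \<Rightarrow> real) \<Rightarrow> 'n xy \<Rightarrow> real" where
  "hd0 G f z = (\<Sum>i\<in>UNIV. hd_cov G i f z * snd z $ i)"

text \<open>\<open>vh_cov G i j f\<close> is \<open>f\<^sub>.\<^sub>i\<^sub>;\<^sub>j\<close> and \<open>vh0 G i f\<close> is \<open>f\<^sub>.\<^sub>i\<^sub>;\<^sub>0\<close>.\<close>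

definition vh_cov ::
    "('n::finite xy \<Rightarrow> real ^ 'n) \<Rightarrow> 'n \<Rightarrow> 'n \<Rightarrow> ('n xy \<Rightarrow> real) \<Rightarrow> 'n xy \<Rightarrow> real" where
  "vh_cov G i j f z =
     hd_cov G j (dy i f) z - (\<Sum>r\<in>UNIV. dy r f z * berwald_conn G r i j z)"

definition vh0 :: "('n::finite xy \<Rightarrow> real ^ 'n) \<Rightarrow> 'n \<Rightarrow> ('n xy \<Rightarrow> real) \<Rightarrow> 'n xy \<Rightarrow> real" where
  "vh0 G i f z = (\<Sum>j\<in>UNIV. vh_cov G i j f z * snd z $ j)"

definition delta :: "'n \<Rightarrow> 'n \<Rightarrow> real" where
  "delta i k = (if i = k then 1 else 0)"

section \<open>Curvature\<close>

definition riemann :: "('n::finite xy \<Rightarrow> real ^ 'n) \<Rightarrow> 'n \<Rightarrow> 'n \<Rightarrow> 'n xy \<Rightarrow> real" where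
  "riemann G i k z =
     2 * dx k (comp G i) z
     - (\<Sum>j\<in>UNIV. snd z $ j * dx j (dy k (comp G i)) z)
     + 2 * (\<Sum>j\<in>UNIV. comp G j z * dy j (dy k (comp G i)) z)
     - (\<Sum>j\<in>UNIV. dy j (comp G i) z * dy k (comp G j) z)"

definition Ric :: "('n::finite xy \<Rightarrow> real ^ 'n) \<Rightarrow> 'n xy \<Rightarrow> real" where
  "Ric G z = (\<Sum>i\<in>UNIV. riemann G i i z)"

definition ricci_scalar :: "('n::finite xy \<Rightarrow> real ^ 'n) \<Rightarrow> 'n xy \<Rightarrow> real" where
  "ricci_scalar G z = Ric G z / (real CARD('n) - 1)"

text \<open>
  \<open>R\<close> and \<open>\<tau>\<close> are the chartwise functions in the local formula
  \<open>R\<^sup>i\<^sub>k = R \<delta>\<^sup>i\<^sub>k - \<tau>\<^sub>k y\<^sup>i\<close>. No coordinate transformation rule is imposed on them: for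
  \<open>n \<ge> 2\<close> they are determined by the tensor \<open>R\<^sup>i\<^sub>k\<close> (with \<open>R = Ric/(n - 1)\<close>), so
  they transform as a function and as the components of a covector.
\<close>

definition scalar_curvature_with ::
    "('m, 'n::finite) chart set \<Rightarrow> (('m, 'n) chart \<Rightarrow> 'n xy set) \<Rightarrow>
     (('m, 'n) chart \<Rightarrow> 'n xy \<Rightarrow> real ^ 'n) \<Rightarrow>
     (('m, 'n) chart \<Rightarrow> 'n xy \<Rightarrow> real) \<Rightarrow> (('m, 'n) chart \<Rightarrow> 'n \<Rightarrow> 'n xy \<Rightarrow> real) \<Rightarrow> bool" where
  "scalar_curvature_with A D G R \<tau> \<longleftrightarrow>
     (\<forall>c\<in>A.
        smooth_on (D c) (R c) \<and> pos_homogeneous 2 (D c) (R c) \<and>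
        (\<forall>k. smooth_on (D c) (\<tau> c k) \<and> pos_homogeneous 1 (D c) (\<tau> c k)) \<and>
        (\<forall>z\<in>D c. \<forall>i k. riemann (G c) i k z = R c z * delta i k - \<tau> c k z * snd z $ i))"

definition scalar_curvature ::
    "('m, 'n::finite) chart set \<Rightarrow> (('m, 'n) chart \<Rightarrow> 'n xy set) \<Rightarrow>
     (('m, 'n) chart \<Rightarrow> 'n xy \<Rightarrow> real ^ 'n) \<Rightarrow> bool" where
  "scalar_curvature A D G \<longleftrightarrow> (\<exists>R \<tau>. scalar_curvature_with A D G R \<tau>)"

definition isotropic_curvature ::
    "('m, 'n::finite) chart set \<Rightarrow> (('m, 'n) chart \<Rightarrow> 'n xy set) \<Rightarrow>
     (('m, 'n) chart \<Rightarrow> 'n xy \<Rightarrow> real ^ 'n) \<Rightarrow> bool" where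
  "isotropic_curvature A D G \<longleftrightarrow>
     (\<exists>R \<tau>. scalar_curvature_with A D G R \<tau> \<and>
        (\<forall>c\<in>A. \<forall>z\<in>D c. \<forall>i. dy i (R c) z = 2 * \<tau> c i z))"

section \<open>Hamel functions, Funk functions and their sprays\<close>

definition hamel_function ::
    "('m, 'n::finite) chart set \<Rightarrow> (('m, 'n) chart \<Rightarrow> 'n xy set) \<Rightarrow>
     (('m, 'n) chart \<Rightarrow> 'n xy \<Rightarrow> real ^ 'n) \<Rightarrow> (('m, 'n) chart \<Rightarrow> 'n xy \<Rightarrow> real) \<Rightarrow> bool" where
  "hamel_function A D G Q \<longleftrightarrow>
     smooth_function A D Q \<and>
     (\<forall>c\<in>A. pos_homogeneous 1 (D c) (Q c) \<and>
        (\<forall>z\<in>D c. \<forall>k. hd_cov (G c) k (Q c) z = vh0 (G c) k (Q c) z))"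

definition funk_function ::
    "('m, 'n::finite) chart set \<Rightarrow> (('m, 'n) chart \<Rightarrow> 'n xy set) \<Rightarrow>
     (('m, 'n) chart \<Rightarrow> 'n xy \<Rightarrow> real ^ 'n) \<Rightarrow> (('m, 'n) chart \<Rightarrow> 'n xy \<Rightarrow> real) \<Rightarrow> bool" where
  "funk_function A D G Q \<longleftrightarrow>
     smooth_function A D Q \<and>
     (\<forall>c\<in>A. pos_homogeneous 1 (D c) (Q c) \<and>
        (\<forall>z\<in>D c. \<forall>k. hd_cov (G c) k (Q c) z = Q c z * dy k (Q c) z))"

text \<open>\<open>Q\<close> has no zeros; this is what \<open>Q\<^sub>;\<^sub>0/(2Q)\<close> needs.\<close>

definition nonvanishing ::
    "('m, 'n::finite) chart set \<Rightarrow> (('m, 'n) chart \<Rightarrow> 'n xy set) \<Rightarrow>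
     (('m, 'n) chart \<Rightarrow> 'n xy \<Rightarrow> real) \<Rightarrow> bool" where
  "nonvanishing A D Q \<longleftrightarrow> (\<forall>c\<in>A. \<forall>z\<in>D c. Q c z \<noteq> 0)"

definition proj_factor :: "('n::finite xy \<Rightarrow> real ^ 'n) \<Rightarrow> ('n xy \<Rightarrow> real) \<Rightarrow> 'n xy \<Rightarrow> real" where
  "proj_factor G Q z = hd0 G Q z / (2 * Q z)"

text \<open>The Funk spray associated to a Funk function is the same expression.\<close>

definition hamel_spray ::
    "(('m, 'n::finite) chart \<Rightarrow> 'n xy \<Rightarrow> real ^ 'n) \<Rightarrow> (('m, 'n) chart \<Rightarrow> 'n xy \<Rightarrow> real) \<Rightarrow>
     ('m, 'n) chart \<Rightarrow> 'n xy \<Rightarrow> real ^ 'n" where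
  "hamel_spray G Q c z = G c z + proj_factor (G c) (Q c) z *\<^sub>R snd z"

text \<open>\<open>R\<^sup>i\<^sub>k = \<lambda> (Q\<^sup>2 \<delta>\<^sup>i\<^sub>k - Q Q\<^sub>.\<^sub>k y\<^sup>i)\<close>.\<close>

definition riemann_form ::
    "('m, 'n::finite) chart set \<Rightarrow> (('m, 'n) chart \<Rightarrow> 'n xy set) \<Rightarrow>
     (('m, 'n) chart \<Rightarrow> 'n xy \<Rightarrow> real ^ 'n) \<Rightarrow> (('m, 'n) chart \<Rightarrow> 'n xy \<Rightarrow> real) \<Rightarrow>
     (('m, 'n) chart \<Rightarrow> 'n xy \<Rightarrow> real) \<Rightarrow> bool" where
  "riemann_form A D G Q lam \<longleftrightarrow>
     (\<forall>c\<in>A. \<forall>z\<in>D c. \<forall>i k.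
        riemann (G c) i k z =
        lam c z * ((Q c z)\<^sup>2 * delta i k - Q c z * dy k (Q c) z * snd z $ i))"

text \<open>
  \<open>\<lambda> = \<lambda>(x)\<close>. A conical region may have disconnected fibres
  \<open>{y. (x, y) \<in> D}\<close>, and the geometry over different components of a fibre is unrelated (one
  may take metrics of different constant curvature there). Hence \<open>\<lambda>\<close> is required to be
  constant on every connected component of every fibre. For connected fibres this is the literal
  condition, see \<open>depends_on_position_connected\<close> below.
\<close>

definition depends_on_position ::
    "('m, 'n::finite) chart set \<Rightarrow> (('m, 'n) chart \<Rightarrow> 'n xy set) \<Rightarrow>
     (('m, 'n) chart \<Rightarrow> 'n xy \<Rightarrow> real) \<Rightarrow> bool" where
  "depends_on_position A D lam \<longleftrightarrow>
     (\<forall>c\<in>A. \<forall>x y y'. connected_component {v. (x, v) \<in> D c} y y' \<longrightarrow>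
        lam c (x, y) = lam c (x, y'))"

lemma depends_on_position_connected:
  assumes "\<And>c x. c \<in> A \<Longrightarrow> connected {v. (x, v) \<in> D c}"
  shows "depends_on_position A D lam \<longleftrightarrow>
    (\<exists>l. \<forall>c\<in>A. \<forall>(x, y)\<in>D c. lam c (x, y) = l c x)"
proof
  assume dep: "depends_on_position A D lam"
  have "lam c (x, y) = lam c (x, SOME v. (x, v) \<in> D c)" if "c \<in> A" "(x, y) \<in> D c" for c x y
  proof -
    have "(x, SOME v. (x, v) \<in> D c) \<in> D c"
      using that(2) by (rule someI)
    then have "connected_component {v. (x, v) \<in> D c} y (SOME v. (x, v) \<in> D c)"
      using assms[OF that(1), of x] that(2) by (auto simp: connected_iff_connected_component)
    then show ?thesis
      using dep that(1) unfolding depends_on_position_def by blast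
  qed
  then show "\<exists>l. \<forall>c\<in>A. \<forall>(x, y)\<in>D c. lam c (x, y) = l c x"
    by (intro exI[of _ "\<lambda>c x. lam c (x, SOME v. (x, v) \<in> D c)"]) auto
next
  assume "\<exists>l. \<forall>c\<in>A. \<forall>(x, y)\<in>D c. lam c (x, y) = l c x"
  then obtain l where l: "\<And>c x y. c \<in> A \<Longrightarrow> (x, y) \<in> D c \<Longrightarrow> lam c (x, y) = l c x"
    by blast
  show "depends_on_position A D lam"
    unfolding depends_on_position_def
  proof (intro ballI allI impI)
    fix c x y y'
    assume c: "c \<in> A" and "connected_component {v. (x, v) \<in> D c} y y'"
    then have "(x, y) \<in> D c" "(x, y') \<in> D c"
      using connected_component_in by blast+
    then show "lam c (x, y) = lam c (x, y')"
      using l[OF c] by simp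
  qed
qed

end

theory Submission
  imports Defs
begin

text \<open>
  The whole theorem is local: both sides of each equivalence are statements about every chart, so
  one works on an open conical set in coordinates \<open>(x, y)\<close>. Let \<open>S = y\<^sup>i \<partial>\<^sub>i - 2 G\<^sup>i \<partial>'\<^sub>i\<close>
  be the spray as a derivation (\<open>\<partial>\<^sub>i\<close>, \<open>\<partial>'\<^sub>i\<close> are the derivatives in \<open>x\<close> and \<open>y\<close>).
  Euler's identity for homogeneous functions gives \<open>f\<^sub>;\<^sub>0 = S f\<close>, and commuting \<open>S\<close> with \<open>\<partial>'\<^sub>k\<close>
  gives \<open>f\<^sub>.\<^sub>k\<^sub>;\<^sub>0 = (S f)\<^sub>.\<^sub>k - f\<^sub>;\<^sub>k\<close> for every \<open>f\<close>.

  Hence \<open>Q\<close> is a Hamel function iff \<open>2 Q\<^sub>;\<^sub>k = (S Q)\<^sub>.\<^sub>k\<close>. With \<open>P = Q\<^sub>;\<^sub>0 / (2 Q)\<close> the right-hand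
  side is \<open>(2 P Q)\<^sub>.\<^sub>k\<close>, and this says exactly that \<open>Q\<close> is horizontally constant for the
  projectively changed spray \<open>G\<^sup>i + P y\<^sup>i\<close> (\<open>hamel_parallel\<close>). For a horizontally constant
  function, applying the spray once more to the equations \<open>\<partial>\<^sub>k Q = G\<^sup>r\<^sub>k Q\<^sub>.\<^sub>r\<close> yields
  \<open>R\<^sup>i\<^sub>k Q\<^sub>.\<^sub>i = 0\<close> (\<open>riemann_annihilates_parallel\<close>). If now \<open>R\<^sup>i\<^sub>k = R \<delta>\<^sup>i\<^sub>k - \<tau>\<^sub>k y\<^sup>i\<close> for the
  changed spray, contraction with \<open>Q\<^sub>.\<^sub>i\<close> forces \<open>\<tau>\<^sub>k = R Q\<^sub>.\<^sub>k / Q\<close>, so only the function \<open>R\<close>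
  remains to be found. It is a trace, namely the Ricci curvature of the changed spray divided by
  \<open>n - 1\<close>, and \<open>Ric_proj_change\<close> computes it as \<open>Ric / (n - 1) + P\<^sup>2 - P\<^sub>;\<^sub>0\<close>. This is
  \<open>\<lambda> Q\<^sup>2\<close>, and the curvature has the asserted form. Conversely, the coefficients in that form are
  smooth and homogeneous of the right degrees, so it exhibits scalar curvature.

  For a Funk function one has \<open>S Q = Q\<^sup>2\<close>; hence it is a Hamel function with \<open>P = Q / 2\<close> and
  \<open>P\<^sup>2 - P\<^sub>;\<^sub>0 = - Q\<^sup>2 / 4\<close>. The coefficients are now determined as above, and since
  \<open>(\<lambda> Q\<^sup>2)\<^sub>.\<^sub>k = \<lambda>\<^sub>.\<^sub>k Q\<^sup>2 + 2 \<lambda> Q Q\<^sub>.\<^sub>k = \<lambda>\<^sub>.\<^sub>k Q\<^sup>2 + 2 \<tau>\<^sub>k\<close>, isotropy means \<open>\<lambda>\<^sub>.\<^sub>k = 0\<close>, which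
  is constancy of \<open>\<lambda>\<close> on the components of the fibres (\<open>fibre_constant_iff\<close>).
\<close>

section \<open>Calculus of smooth real functions\<close>

text \<open>
  The functions to be differentiated again are derivatives, for which the rules of calculus give
  formulas on \<open>S\<close> only. Replacing them by these formulas is legitimate because \<open>S\<close> is open.
\<close>

lemma Ck_on_cong:
  assumes "open S" "Ck_on m S f" "\<And>x. x \<in> S \<Longrightarrow> f x = g x"
  shows "Ck_on m S g"
  using assms(2,3)
proof (induction m arbitrary: f g)
  case 0
  then show ?case by (simp cong: continuous_on_cong)
next
  case (Suc m)
  have "frechet_derivative f (at x) = frechet_derivative g (at x)" if "x \<in> S" for x
    using Suc.prems that assms(1) frechet_derivative_transform_within_open[of f x S g] by auto
  moreover have "g differentiable (at x)" if "x \<in> S" for x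
    using Suc.prems that assms(1) unfolding differentiable_def
    by (metis Ck_on.simps(2) frechet_derivative_works has_derivative_transform_within_open)
  ultimately show ?case
    using Suc.prems Suc.IH[of "\<lambda>x. frechet_derivative f (at x) v" "\<lambda>x. frechet_derivative g (at x) v" for v]
    by auto
qed

lemma Ck_on_SucD: "Ck_on (Suc m) S f \<Longrightarrow> Ck_on m S f"
proof (induction m arbitrary: f)
  case 0
  then show ?case
    by (simp add: continuous_at_imp_continuous_on differentiable_imp_continuous_within)
next
  case (Suc m)
  have "Ck_on m S (\<lambda>x. frechet_derivative f (at x) v)" for v
    by (rule Suc.IH) (use Suc.prems in simp)
  then show ?case using Suc.prems by simp
qed

lemma Ck_on_subset: "Ck_on m S f \<Longrightarrow> T \<subseteq> S \<Longrightarrow> Ck_on m T f"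
  by (induction m arbitrary: f) (auto intro: continuous_on_subset)

lemma Ck_on_const [simp]: "Ck_on m S (\<lambda>_. c)"
  by (induction m arbitrary: c) auto

lemma Ck_on_bounded_linear:
  assumes "open S" "bounded_linear L" "Ck_on m S f"
  shows "Ck_on m S (\<lambda>x. L (f x))"
  using assms(3)
proof (induction m arbitrary: f)
  case 0
  then show ?case using assms(2) by (simp add: bounded_linear.continuous_on)
next
  case (Suc m)
  have d: "((\<lambda>x. L (f x)) has_derivative (\<lambda>v. L (frechet_derivative f (at x) v))) (at x)" if "x \<in> S" for x
    by (rule bounded_linear.has_derivative[OF assms(2)])
       (use Suc.prems that in \<open>simp add: frechet_derivative_works[symmetric]\<close>)
  have "Ck_on m S (\<lambda>x. frechet_derivative (\<lambda>x. L (f x)) (at x) v)" for v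
  proof (rule Ck_on_cong[OF assms(1)])
    show "Ck_on m S (\<lambda>x. L (frechet_derivative f (at x) v))"
      using Suc.prems by (intro Suc.IH) auto
  qed (rule fun_cong[OF frechet_derivative_at[OF d], of _ v])
  moreover have "\<forall>x\<in>S. (\<lambda>x. L (f x)) differentiable (at x)"
    using d unfolding differentiable_def by blast
  ultimately show ?case by simp
qed

lemma Ck_on_linear:
  assumes "bounded_linear L"
  shows "Ck_on m S L"
proof (cases m)
  case 0
  then show ?thesis using assms by (simp add: linear_continuous_on)
next
  case (Suc k)
  have "frechet_derivative L (at x) = L" for x
    by (rule frechet_derivative_at[OF bounded_linear_imp_has_derivative[OF assms], symmetric])
  then show ?thesis using Suc assms by (simp add: bounded_linear_imp_differentiable)
qed

lemma Ck_on_add: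
  assumes "open S" "Ck_on m S f" "Ck_on m S g"
  shows "Ck_on m S (\<lambda>x. f x + g x)"
  using assms(2,3)
proof (induction m arbitrary: f g)
  case 0
  then show ?case by (auto intro: continuous_intros)
next
  case (Suc m)
  have d: "((\<lambda>x. f x + g x) has_derivative
      (\<lambda>v. frechet_derivative f (at x) v + frechet_derivative g (at x) v)) (at x)" if "x \<in> S" for x
    by (rule has_derivative_add)
       (use Suc.prems that in \<open>simp_all add: frechet_derivative_works[symmetric]\<close>)
  have "Ck_on m S (\<lambda>x. frechet_derivative (\<lambda>x. f x + g x) (at x) v)" for v
  proof (rule Ck_on_cong[OF assms(1)])
    show "Ck_on m S (\<lambda>x. frechet_derivative f (at x) v + frechet_derivative g (at x) v)"
      using Suc.prems by (intro Suc.IH) auto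
  qed (rule fun_cong[OF frechet_derivative_at[OF d], of _ v])
  moreover have "\<forall>x\<in>S. (\<lambda>x. f x + g x) differentiable (at x)"
    using d unfolding differentiable_def by blast
  ultimately show ?case by simp
qed

text \<open>
  The derivative of a product contains the factors themselves, so the induction also uses them one
  order of differentiability lower.
\<close>

lemma Ck_on_mult:
  fixes f g :: "'a::euclidean_space \<Rightarrow> real"
  assumes "open S" "Ck_on m S f" "Ck_on m S g"
  shows "Ck_on m S (\<lambda>x. f x * g x)"
  using assms(2,3)
proof (induction m arbitrary: f g)
  case 0
  then show ?case by (auto intro: continuous_intros)
next
  case (Suc m)
  have d: "((\<lambda>x. f x * g x) has_derivative
      (\<lambda>v. f x * frechet_derivative g (at x) v + frechet_derivative f (at x) v * g x)) (at x)"
    if "x \<in> S" for x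
    by (rule has_derivative_mult)
       (use Suc.prems that in \<open>simp_all add: frechet_derivative_works[symmetric]\<close>)
  have "Ck_on m S (\<lambda>x. frechet_derivative (\<lambda>x. f x * g x) (at x) v)" for v
  proof (rule Ck_on_cong[OF assms(1)])
    show "Ck_on m S (\<lambda>x. f x * frechet_derivative g (at x) v + frechet_derivative f (at x) v * g x)"
      using Suc.prems by (intro Ck_on_add[OF assms(1)] Suc.IH Ck_on_SucD[OF Suc.prems(1)]
          Ck_on_SucD[OF Suc.prems(2)]) simp_all
  qed (rule fun_cong[OF frechet_derivative_at[OF d], of _ v])
  moreover have "\<forall>x\<in>S. (\<lambda>x. f x * g x) differentiable (at x)"
    using d unfolding differentiable_def by blast
  ultimately show ?case by simp
qed

lemma Ck_on_inverse:
  fixes f :: "'a::euclidean_space \<Rightarrow> real"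
  assumes "open S" "Ck_on m S f" "\<And>x. x \<in> S \<Longrightarrow> f x \<noteq> 0"
  shows "Ck_on m S (\<lambda>x. inverse (f x))"
  using assms(2)
proof (induction m)
  case 0
  then show ?case using assms(3) by (auto intro: continuous_intros)
next
  case (Suc m)
  have d: "((\<lambda>x. inverse (f x)) has_derivative
      (\<lambda>v. (- 1) * (inverse (f x) * frechet_derivative f (at x) v * inverse (f x)))) (at x)"
    if "x \<in> S" for x
  proof -
    have "(f has_derivative frechet_derivative f (at x)) (at x)"
      using Suc.prems that by (simp add: frechet_derivative_works[symmetric])
    from Deriv.has_derivative_inverse[OF assms(3)[OF that] this] show ?thesis by simp
  qed
  have i: "Ck_on m S (\<lambda>x. inverse (f x))"
    by (rule Suc.IH[OF Ck_on_SucD[OF Suc.prems]])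
  have "Ck_on m S (\<lambda>x. frechet_derivative (\<lambda>x. inverse (f x)) (at x) v)" for v
  proof (rule Ck_on_cong[OF assms(1)])
    show "Ck_on m S (\<lambda>x. (- 1) * (inverse (f x) * frechet_derivative f (at x) v * inverse (f x)))"
      using Suc.prems by (intro Ck_on_mult[OF assms(1)] Ck_on_const i) simp
  qed (rule fun_cong[OF frechet_derivative_at[OF d], of _ v])
  moreover have "\<forall>x\<in>S. (\<lambda>x. inverse (f x)) differentiable (at x)"
    using d unfolding differentiable_def by blast
  ultimately show ?case by simp
qed

text \<open>
  With the direction as first argument, \<open>dx k\<close>, \<open>dy k\<close> and the action of a spray are all of the
  form \<open>dirderiv v\<close> at each point, so the rules of calculus are proved once for all of them.
\<close>

definition dirderiv :: "'a::euclidean_space \<Rightarrow> ('a \<Rightarrow> real) \<Rightarrow> 'a \<Rightarrow> real" where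
  "dirderiv v f z = frechet_derivative f (at z) v"

lemma smooth_on_differentiable: "smooth_on S f \<Longrightarrow> x \<in> S \<Longrightarrow> f differentiable (at x)"
  unfolding smooth_on_def by (drule spec[of _ "Suc 0"]) simp

lemma smooth_on_has_derivative:
  "smooth_on S f \<Longrightarrow> x \<in> S \<Longrightarrow> (f has_derivative frechet_derivative f (at x)) (at x)"
  by (rule frechet_derivative_works[THEN iffD1, OF smooth_on_differentiable])

lemma smooth_on_dirderiv:
  assumes "smooth_on S f"
  shows "smooth_on S (dirderiv v f)"
proof -
  have "Ck_on m S (\<lambda>z. frechet_derivative f (at z) v)" for m
    using assms[unfolded smooth_on_def, rule_format, of "Suc m"] by simp
  then show ?thesis
    by (simp add: smooth_on_def dirderiv_def[abs_def])
qed

lemma smooth_on_continuous: "smooth_on S f \<Longrightarrow> continuous_on S f"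
  unfolding smooth_on_def by (drule spec[of _ 0]) simp

lemma smooth_on_cong:
  assumes "open S" "smooth_on S f" "\<And>x. x \<in> S \<Longrightarrow> f x = g x"
  shows "smooth_on S g"
  unfolding smooth_on_def
proof
  fix m
  have "Ck_on m S f" using assms(2) by (simp add: smooth_on_def)
  then show "Ck_on m S g" by (rule Ck_on_cong[OF assms(1) _ assms(3)])
qed

lemma smooth_on_subset: "smooth_on S f \<Longrightarrow> T \<subseteq> S \<Longrightarrow> smooth_on T f"
  unfolding smooth_on_def using Ck_on_subset by blast

lemma smooth_on_const: "smooth_on S (\<lambda>_. c)"
  unfolding smooth_on_def by simp

lemma smooth_on_linear: "bounded_linear L \<Longrightarrow> smooth_on S L"
  by (simp add: smooth_on_def Ck_on_linear)

lemma smooth_on_bounded_linear: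
  assumes "open S" "bounded_linear L" "smooth_on S f"
  shows "smooth_on S (\<lambda>x. L (f x))"
  unfolding smooth_on_def
proof
  fix m
  have "Ck_on m S f" using assms(3) by (simp add: smooth_on_def)
  then show "Ck_on m S (\<lambda>x. L (f x))" by (rule Ck_on_bounded_linear[OF assms(1,2)])
qed

lemma smooth_on_add:
  "open S \<Longrightarrow> smooth_on S f \<Longrightarrow> smooth_on S g \<Longrightarrow> smooth_on S (\<lambda>x. f x + g x)"
  by (simp add: smooth_on_def Ck_on_add)

lemma smooth_on_mult:
  fixes f g :: "'a::euclidean_space \<Rightarrow> real"
  shows "open S \<Longrightarrow> smooth_on S f \<Longrightarrow> smooth_on S g \<Longrightarrow> smooth_on S (\<lambda>x. f x * g x)"
  by (simp add: smooth_on_def Ck_on_mult)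

lemma smooth_on_diff:
  fixes f g :: "'a::euclidean_space \<Rightarrow> real"
  assumes "open S" "smooth_on S f" "smooth_on S g"
  shows "smooth_on S (\<lambda>x. f x - g x)"
  using smooth_on_add[OF assms(1,2) smooth_on_mult[OF assms(1) smooth_on_const[of S "-1"] assms(3)]]
  by simp

lemma smooth_on_divide:
  fixes f g :: "'a::euclidean_space \<Rightarrow> real"
  assumes "open S" "smooth_on S f" "smooth_on S g" "\<And>x. x \<in> S \<Longrightarrow> g x \<noteq> 0"
  shows "smooth_on S (\<lambda>x. f x / g x)"
proof -
  have "smooth_on S (\<lambda>x. inverse (g x))"
    using assms by (simp add: smooth_on_def Ck_on_inverse)
  then show ?thesis
    using smooth_on_mult[OF assms(1,2)] by (simp add: divide_inverse)
qed

lemma smooth_on_sum: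
  assumes "open S" "\<And>i. i \<in> I \<Longrightarrow> smooth_on S (f i)"
  shows "smooth_on S (\<lambda>x. \<Sum>i\<in>I. f i x)"
  using assms(2)
proof (induction I rule: infinite_finite_induct)
  case (insert i I)
  then show ?case using smooth_on_add[OF assms(1), of "f i" "\<lambda>x. \<Sum>i\<in>I. f i x"] by simp
qed (simp_all add: smooth_on_const)

lemma dirderiv_unique: "(f has_derivative f') (at z) \<Longrightarrow> dirderiv v f z = f' v"
  unfolding dirderiv_def by (rule fun_cong[OF frechet_derivative_at, symmetric])

lemma dirderiv_cong:
  assumes "open S" "z \<in> S" "smooth_on S f" "\<And>x. x \<in> S \<Longrightarrow> f x = g x"
  shows "dirderiv v f z = dirderiv v g z"
  unfolding dirderiv_def
  by (rule fun_cong[OF frechet_derivative_transform_within_open[OF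
          smooth_on_differentiable[OF assms(3,2)] assms(1,2,4)]])

lemma dirderiv_const: "dirderiv v (\<lambda>_. c) z = 0"
  unfolding dirderiv_def by simp

lemma dirderiv_linear: "bounded_linear L \<Longrightarrow> dirderiv v L z = L v"
  by (rule dirderiv_unique[OF bounded_linear_imp_has_derivative])

lemma dirderiv_add:
  assumes "smooth_on S f" "smooth_on S g" "z \<in> S"
  shows "dirderiv v (\<lambda>x. f x + g x) z = dirderiv v f z + dirderiv v g z"
  by (rule dirderiv_unique[OF has_derivative_add[OF assms(1,2)[THEN smooth_on_has_derivative, OF assms(3)]],
        folded dirderiv_def])

lemma dirderiv_diff:
  assumes "smooth_on S f" "smooth_on S g" "z \<in> S"
  shows "dirderiv v (\<lambda>x. f x - g x) z = dirderiv v f z - dirderiv v g z"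
  by (rule dirderiv_unique[OF has_derivative_diff[OF assms(1,2)[THEN smooth_on_has_derivative, OF assms(3)]],
        folded dirderiv_def])

lemma dirderiv_mult:
  assumes "smooth_on S f" "smooth_on S g" "z \<in> S"
  shows "dirderiv v (\<lambda>x. f x * g x) z = dirderiv v f z * g z + f z * dirderiv v g z"
proof -
  have "((\<lambda>x. f x * g x) has_derivative
      (\<lambda>v. f z * dirderiv v g z + dirderiv v f z * g z)) (at z)"
    unfolding dirderiv_def
    by (rule has_derivative_mult[OF assms(1,2)[THEN smooth_on_has_derivative, OF assms(3)]])
  from dirderiv_unique[OF this] show ?thesis by (simp only: add.commute)
qed

lemma dirderiv_sum:
  assumes "\<And>i. i \<in> I \<Longrightarrow> smooth_on S (f i)" "z \<in> S"
  shows "dirderiv v (\<lambda>x. \<Sum>i\<in>I. f i x) z = (\<Sum>i\<in>I. dirderiv v (f i) z)"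
proof -
  have "((\<lambda>x. \<Sum>i\<in>I. f i x) has_derivative (\<lambda>v. \<Sum>i\<in>I. frechet_derivative (f i) (at z) v)) (at z)"
    by (intro has_derivative_sum smooth_on_has_derivative[of S] assms)
  from dirderiv_unique[OF this, folded dirderiv_def] show ?thesis .
qed

lemma dirderiv_linear_direction:
  assumes "smooth_on S f" "z \<in> S"
  shows "linear (\<lambda>v. dirderiv v f z)"
  unfolding dirderiv_def by (rule has_derivative_linear[OF smooth_on_has_derivative[OF assms]])

section \<open>Symmetry of second derivatives\<close>

text \<open>
  The mean value theorem, applied in the direction \<open>v\<close> and then in the direction \<open>w\<close>. The left-hand
  side of the equation is symmetric in \<open>v\<close> and \<open>w\<close>, the right-hand side is not; this asymmetry is
  what makes the mixed derivatives agree in the limit.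
\<close>

lemma second_difference_mean_value:
  fixes f :: "'a::euclidean_space \<Rightarrow> real"
  assumes f: "smooth_on (ball z d) f" and h: "h > 0" "h * (norm v + norm w) < d"
  obtains p where "p \<in> ball z d"
    "f (z + h *\<^sub>R v + h *\<^sub>R w) - f (z + h *\<^sub>R v) - f (z + h *\<^sub>R w) + f z
      = h\<^sup>2 * dirderiv w (dirderiv v f) p"
proof -
  have in_ball: "z + s *\<^sub>R v + t *\<^sub>R w \<in> ball z d" if "0 \<le> s" "s \<le> h" "0 \<le> t" "t \<le> h" for s t
  proof -
    have "norm (s *\<^sub>R v + t *\<^sub>R w) \<le> s * norm v + t * norm w"
      using that norm_triangle_ineq[of "s *\<^sub>R v" "t *\<^sub>R w"] by simp
    also have "\<dots> \<le> h * norm v + h * norm w"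
      using that by (intro add_mono mult_right_mono) auto
    also have "\<dots> < d" using h by (simp add: algebra_simps)
    finally show ?thesis by (metis add.assoc dist_add_cancel dist_0_norm add.right_neutral mem_ball)
  qed
  have der: "((\<lambda>s. g (a + s *\<^sub>R u)) has_real_derivative dirderiv u g (a + s *\<^sub>R u)) (at s)"
    if "smooth_on (ball z d) g" "a + s *\<^sub>R u \<in> ball z d" for g a u s
  proof -
    have "((\<lambda>s. a + s *\<^sub>R u) has_derivative (\<lambda>t. t *\<^sub>R u)) (at s)"
      by (auto intro!: derivative_eq_intros)
    from has_derivative_compose[OF this, of g "frechet_derivative g (at (a + s *\<^sub>R u))"]
    have "((\<lambda>s. g (a + s *\<^sub>R u)) has_derivative
        (\<lambda>t. frechet_derivative g (at (a + s *\<^sub>R u)) (t *\<^sub>R u))) (at s)"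
      using smooth_on_has_derivative[OF that] by simp
    then show ?thesis
      using has_derivative_linear[OF smooth_on_has_derivative[OF that]]
      unfolding has_field_derivative_def dirderiv_def
      by (simp add: linear_scale mult_commute_abs)
  qed
  \<comment> \<open>the difference in direction w of f, as a function of the step s in direction v\<close>
  have "\<exists>\<xi>>0. \<xi> < h \<and> (f (z + h *\<^sub>R w + h *\<^sub>R v) - f (z + h *\<^sub>R v)) - (f (z + h *\<^sub>R w + 0 *\<^sub>R v) - f (z + 0 *\<^sub>R v))
     = (h - 0) * (dirderiv v f (z + h *\<^sub>R w + \<xi> *\<^sub>R v) - dirderiv v f (z + \<xi> *\<^sub>R v))"
  proof (rule MVT2[OF h(1)])
    fix s assume s: "0 \<le> s" "s \<le> h"
    show "((\<lambda>s. f (z + h *\<^sub>R w + s *\<^sub>R v) - f (z + s *\<^sub>R v)) has_real_derivative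
       dirderiv v f (z + h *\<^sub>R w + s *\<^sub>R v) - dirderiv v f (z + s *\<^sub>R v)) (at s)"
      using in_ball[of s h] in_ball[of s 0] s h
      by (intro DERIV_diff der f) (auto simp: add_ac)
  qed
  then obtain \<xi> where \<xi>: "0 < \<xi>" "\<xi> < h" and
    1: "f (z + h *\<^sub>R v + h *\<^sub>R w) - f (z + h *\<^sub>R v) - f (z + h *\<^sub>R w) + f z
     = h * (dirderiv v f (z + \<xi> *\<^sub>R v + h *\<^sub>R w) - dirderiv v f (z + \<xi> *\<^sub>R v))"
    by (auto simp: algebra_simps)
  have "\<exists>\<eta>>0. \<eta> < h \<and> dirderiv v f (z + \<xi> *\<^sub>R v + h *\<^sub>R w) - dirderiv v f (z + \<xi> *\<^sub>R v + 0 *\<^sub>R w)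
     = (h - 0) * dirderiv w (dirderiv v f) (z + \<xi> *\<^sub>R v + \<eta> *\<^sub>R w)"
    by (rule MVT2[OF h(1)]) (use in_ball \<xi> in \<open>auto intro!: der smooth_on_dirderiv f\<close>)
  then obtain \<eta> where \<eta>: "0 < \<eta>" "\<eta> < h" and
    2: "dirderiv v f (z + \<xi> *\<^sub>R v + h *\<^sub>R w) - dirderiv v f (z + \<xi> *\<^sub>R v)
     = h * dirderiv w (dirderiv v f) (z + \<xi> *\<^sub>R v + \<eta> *\<^sub>R w)"
    by auto
  show thesis
    using that[of "z + \<xi> *\<^sub>R v + \<eta> *\<^sub>R w"] in_ball[of \<xi> \<eta>] \<xi> \<eta> 1 2
    by (simp add: power2_eq_square)
qed

text \<open>
  If the two mixed derivatives differed at \<open>z\<close>, continuity would keep them apart on a small ball,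
  yet a second difference divided by \<open>h\<^sup>2\<close> is a value of both.
\<close>

lemma dirderiv_commute:
  fixes f :: "'a::euclidean_space \<Rightarrow> real"
  assumes S: "open S" "z \<in> S" and f: "smooth_on S f"
  shows "dirderiv v (dirderiv w f) z = dirderiv w (dirderiv v f) z"
proof (rule ccontr)
  let ?a = "dirderiv v (dirderiv w f)" and ?b = "dirderiv w (dirderiv v f)"
  assume ne: "?a z \<noteq> ?b z"
  define e where "e = \<bar>?a z - ?b z\<bar> / 2"
  have "e > 0" using ne by (simp add: e_def)
  have cont: "isCont ?a z" "isCont ?b z"
    using S f by (meson continuous_on_eq_continuous_at smooth_on_continuous smooth_on_dirderiv)+
  obtain d1 where d1: "d1 > 0" "ball z d1 \<subseteq> S" using S openE by blast
  obtain d2 where d2: "d2 > 0" "\<And>x. dist x z < d2 \<Longrightarrow> dist (?a x) (?a z) < e"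
    using cont(1) \<open>e > 0\<close> unfolding continuous_at_eps_delta by (metis UNIV_I)
  obtain d3 where d3: "d3 > 0" "\<And>x. dist x z < d3 \<Longrightarrow> dist (?b x) (?b z) < e"
    using cont(2) \<open>e > 0\<close> unfolding continuous_at_eps_delta by (metis UNIV_I)
  define d where "d = min d1 (min d2 d3)"
  have d: "d > 0" "smooth_on (ball z d) f"
    using d1 d2 d3 subset_ball[of d d1 z] by (auto simp: d_def intro!: smooth_on_subset[OF f])
  \<comment> \<open>the summand 1 in the denominator covers the case \<open>v = w = 0\<close>\<close>
  define h where "h = d / (norm v + norm w + 1)"
  have den: "norm v + norm w + 1 > 0" by (smt (verit) norm_ge_zero)
  have h: "h > 0" "h * (norm v + norm w) < d"
    using d(1) den by (auto simp: h_def field_simps)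
  obtain p where p: "p \<in> ball z d"
    "f (z + h *\<^sub>R v + h *\<^sub>R w) - f (z + h *\<^sub>R v) - f (z + h *\<^sub>R w) + f z = h\<^sup>2 * ?b p"
    using second_difference_mean_value[OF d(2) h] by blast
  have h': "h * (norm w + norm v) < d" using h by (simp add: add.commute)
  obtain q where q: "q \<in> ball z d"
    "f (z + h *\<^sub>R w + h *\<^sub>R v) - f (z + h *\<^sub>R w) - f (z + h *\<^sub>R v) + f z = h\<^sup>2 * ?a q"
    using second_difference_mean_value[OF d(2) h(1) h'] by blast
  have "h\<^sup>2 * ?b p = h\<^sup>2 * ?a q" using p(2) q(2) by (simp add: algebra_simps)
  then have "?b p = ?a q" using h by simp
  moreover have "dist (?a q) (?a z) < e" "dist (?b p) (?b z) < e"
    using p(1) q(1) d2(2)[of q] d3(2)[of p] by (auto simp: d_def dist_commute)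
  ultimately have "dist (?a q) (?a z) < e" "dist (?a q) (?b z) < e" by simp_all
  then have "dist (?a z) (?b z) < dist (?a z) (?b z)"
    using dist_triangle_half_r[of "?a q" "?a z" "2 * e" "?b z"] by (simp add: e_def dist_real_def)
  then show False by simp
qed

section \<open>Homogeneous functions on a conical domain\<close>

lemma dx_eq_dirderiv: "dx k = dirderiv (axis k 1, 0)"
  by (simp add: fun_eq_iff dx_def dirderiv_def)

lemma dy_eq_dirderiv: "dy k = dirderiv (0, axis k 1)"
  by (simp add: fun_eq_iff dy_def dirderiv_def)

lemma pos_homogeneousD:
  fixes f :: "'n::finite xy \<Rightarrow> real"
  assumes "pos_homogeneous r S f" "z \<in> S" "t > 0"
  shows "f (fst z, t *\<^sub>R snd z) = t ^ r * f z"
  using assms by (cases z) (auto simp: pos_homogeneous_def)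

lemma pos_homogeneousI:
  fixes f :: "'n::finite xy \<Rightarrow> real"
  assumes "\<And>z t. z \<in> S \<Longrightarrow> t > 0 \<Longrightarrow> f (fst z, t *\<^sub>R snd z) = t ^ r * f z"
  shows "pos_homogeneous r S f"
  using assms by (fastforce simp: pos_homogeneous_def)

lemma dirderiv_coordinates:
  assumes "smooth_on S f" "z \<in> S"
  shows "dirderiv (a, b) f z = (\<Sum>i\<in>UNIV. a $ i * dx i f z) + (\<Sum>i\<in>UNIV. b $ i * dy i f z)"
proof -
  note lin = dirderiv_linear_direction[OF assms]
  have "(a, b) = (\<Sum>i\<in>UNIV. a $ i *\<^sub>R (axis i 1, 0)) + (\<Sum>i\<in>UNIV. b $ i *\<^sub>R (0, axis i 1))"
    by (simp add: prod_eq_iff fst_sum snd_sum vec_eq_iff axis_def if_distrib cong: if_cong)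
  then have "dirderiv (a, b) f z =
      dirderiv ((\<Sum>i\<in>UNIV. a $ i *\<^sub>R (axis i 1, 0)) + (\<Sum>i\<in>UNIV. b $ i *\<^sub>R (0, axis i 1))) f z"
    by simp
  also have "\<dots> = (\<Sum>i\<in>UNIV. a $ i * dx i f z) + (\<Sum>i\<in>UNIV. b $ i * dy i f z)"
    by (simp only: linear_add[OF lin] linear_sum[OF lin] linear_scale[OF lin] real_scaleR_def
        dx_eq_dirderiv dy_eq_dirderiv)
  finally show ?thesis .
qed

abbreviation ycoord :: "'n::finite \<Rightarrow> 'n xy \<Rightarrow> real" where
  "ycoord i z \<equiv> snd z $ i"

lemma bounded_linear_ycoord: "bounded_linear (ycoord i)"
  by (rule bounded_linear_compose[OF bounded_linear_vec_nth bounded_linear_snd])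

lemma dirderiv_ycoord: "dirderiv v (ycoord i) z = snd v $ i"
  by (rule dirderiv_linear[OF bounded_linear_ycoord])

locale conical_domain =
  fixes U :: "'n::finite xy set"
  assumes open_U: "open U"
    and scaling: "\<And>z t. z \<in> U \<Longrightarrow> t > 0 \<Longrightarrow> (fst z, t *\<^sub>R snd z) \<in> U"
begin

lemma smooth_dx: "smooth_on U f \<Longrightarrow> smooth_on U (dx k f)"
  by (simp add: dx_eq_dirderiv smooth_on_dirderiv)

lemma smooth_dy: "smooth_on U f \<Longrightarrow> smooth_on U (dy k f)"
  by (simp add: dy_eq_dirderiv smooth_on_dirderiv)

lemmas smooth_rules =
  smooth_on_add[OF open_U] smooth_on_diff[OF open_U] smooth_on_mult[OF open_U]
  smooth_on_sum[OF open_U] smooth_on_const smooth_on_linear[OF bounded_linear_ycoord]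
  smooth_dx smooth_dy

text \<open>
  Differentiate \<open>f (x, t y) = t\<^sup>r f (x, y)\<close> in \<open>(x, y)\<close>. Directions in the fibre pick up the
  factor \<open>t\<close>, which is why \<open>dy\<close> lowers the degree of homogeneity while \<open>dx\<close> keeps it.
\<close>

lemma dirderiv_scaling:
  assumes f: "smooth_on U f" "pos_homogeneous r U f" and z: "z \<in> U" and t: "t > 0"
  shows "dirderiv (a, t *\<^sub>R b) f (fst z, t *\<^sub>R snd z) = t ^ r * dirderiv (a, b) f z"
proof -
  define m where "m = (\<lambda>w :: 'n xy. (fst w, t *\<^sub>R snd w))"
  have m: "(m has_derivative m) (at z)"
    unfolding m_def by (auto intro!: derivative_eq_intros)
  have "(f has_derivative frechet_derivative f (at (m z))) (at (m z))"
    using smooth_on_has_derivative[OF f(1)] scaling[OF z t] by (simp add: m_def)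
  from has_derivative_compose[OF m this]
  have "((\<lambda>w. f (m w)) has_derivative (\<lambda>v. frechet_derivative f (at (m z)) (m v))) (at z)" .
  from dirderiv_unique[OF this, of "(a, b)"]
  have "dirderiv (a, t *\<^sub>R b) f (fst z, t *\<^sub>R snd z) = dirderiv (a, b) (\<lambda>w. f (m w)) z"
    by (simp add: dirderiv_def m_def)
  also have "\<dots> = dirderiv (a, b) (\<lambda>w. t ^ r * f w) z"
    using pos_homogeneousD[OF f(2) _ t]
    by (intro dirderiv_cong[OF open_U z, symmetric] smooth_rules f) (simp add: m_def)
  also have "\<dots> = t ^ r * dirderiv (a, b) f z"
    by (simp add: dirderiv_mult[OF smooth_on_const f(1) z] dirderiv_const)
  finally show ?thesis .
qed

lemma hom_dx:
  assumes "smooth_on U f" "pos_homogeneous r U f"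
  shows "pos_homogeneous r U (dx k f)"
  by (rule pos_homogeneousI)
     (use dirderiv_scaling[OF assms, where b = 0] in \<open>simp add: dx_eq_dirderiv\<close>)

lemma hom_dy:
  assumes "smooth_on U f" "pos_homogeneous (Suc r) U f"
  shows "pos_homogeneous r U (dy k f)"
proof (rule pos_homogeneousI)
  fix z and t :: real assume z: "z \<in> U" and t: "t > 0"
  have "dirderiv (t *\<^sub>R (0, axis k 1)) f (fst z, t *\<^sub>R snd z) = t ^ Suc r * dy k f z"
    using dirderiv_scaling[OF assms z t, of 0 "axis k 1"] by (simp add: dy_eq_dirderiv)
  then have "t * dy k f (fst z, t *\<^sub>R snd z) = t * (t ^ r * dy k f z)"
    using linear_scale[OF dirderiv_linear_direction[OF assms(1) scaling[OF z t]], of t "(0, axis k 1)"]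
    by (auto simp: dy_eq_dirderiv)
  then show "dy k f (fst z, t *\<^sub>R snd z) = t ^ r * dy k f z"
    using t by simp
qed

lemma hom_mult:
  assumes "pos_homogeneous r U f" "pos_homogeneous s U (g :: _ \<Rightarrow> real)"
  shows "pos_homogeneous (r + s) U (\<lambda>z. f z * g z)"
  by (rule pos_homogeneousI) (simp add: pos_homogeneousD[OF assms(1)] pos_homogeneousD[OF assms(2)] power_add)

lemma hom_divide:
  assumes "pos_homogeneous (r + s) U f" "pos_homogeneous s U (g :: _ \<Rightarrow> real)"
  shows "pos_homogeneous r U (\<lambda>z. f z / g z)"
  by (rule pos_homogeneousI) (simp add: pos_homogeneousD[OF assms(1)] pos_homogeneousD[OF assms(2)] power_add)

lemma hom_add:
  assumes "pos_homogeneous r U f" "pos_homogeneous r U (g :: _ \<Rightarrow> real)"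
  shows "pos_homogeneous r U (\<lambda>z. f z + g z)"
  by (rule pos_homogeneousI)
     (simp add: pos_homogeneousD[OF assms(1)] pos_homogeneousD[OF assms(2)] distrib_left)

lemma hom_diff:
  assumes "pos_homogeneous r U f" "pos_homogeneous r U (g :: _ \<Rightarrow> real)"
  shows "pos_homogeneous r U (\<lambda>z. f z - g z)"
  by (rule pos_homogeneousI)
     (simp add: pos_homogeneousD[OF assms(1)] pos_homogeneousD[OF assms(2)] right_diff_distrib)

lemma hom_cmult:
  assumes "pos_homogeneous r U (f :: _ \<Rightarrow> real)"
  shows "pos_homogeneous r U (\<lambda>z. c * f z)"
  by (rule pos_homogeneousI) (simp add: pos_homogeneousD[OF assms])

lemma hom_sum:
  assumes "\<And>i. i \<in> I \<Longrightarrow> pos_homogeneous r U (f i :: _ \<Rightarrow> real)"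
  shows "pos_homogeneous r U (\<lambda>z. \<Sum>i\<in>I. f i z)"
  by (rule pos_homogeneousI) (simp add: pos_homogeneousD[OF assms] sum_distrib_left)

lemma hom_ycoord: "pos_homogeneous 1 U (ycoord i)"
  by (rule pos_homogeneousI) simp

lemma hom_cong:
  assumes "pos_homogeneous r U (f :: _ \<Rightarrow> real)" "\<And>z. z \<in> U \<Longrightarrow> f z = g z"
  shows "pos_homogeneous r U g"
  by (rule pos_homogeneousI)
     (use pos_homogeneousD[OF assms(1)] assms(2) scaling in metis)

text \<open>
  Euler's identity: differentiate \<open>f (x, t y) = t\<^sup>r f (x, y)\<close> in \<open>t\<close> at \<open>t = 1\<close>.
\<close>

lemma euler:
  assumes f: "smooth_on U f" "pos_homogeneous r U f" and z: "z \<in> U"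
  shows "(\<Sum>i\<in>UNIV. ycoord i z * dy i f z) = real r * f z"
proof -
  have "((\<lambda>t. (fst z, t *\<^sub>R snd z)) has_derivative (\<lambda>t. (0, t *\<^sub>R snd z))) (at 1)"
    by (auto intro!: derivative_eq_intros)
  from has_derivative_compose[OF this, of f "frechet_derivative f (at z)"]
  have 1: "((\<lambda>t. f (fst z, t *\<^sub>R snd z)) has_derivative
      (\<lambda>t. frechet_derivative f (at z) (0, t *\<^sub>R snd z))) (at 1)"
    using smooth_on_has_derivative[OF f(1) z] by simp
  have "((\<lambda>t. t ^ r * f z) has_derivative (\<lambda>t. t * (real r * f z))) (at 1)"
    by (auto intro!: derivative_eq_intros)
  then have 2: "((\<lambda>t. f (fst z, t *\<^sub>R snd z)) has_derivative (\<lambda>t. t * (real r * f z))) (at 1)"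
    by (rule has_derivative_transform_within_open[of _ _ _ _ "{0<..}"])
       (use pos_homogeneousD[OF f(2) z] in auto)
  have "dirderiv (0, snd z) f z = real r * f z"
    using fun_cong[OF has_derivative_unique[OF 1 2], of 1] by (simp add: dirderiv_def)
  then show ?thesis
    using dirderiv_coordinates[OF f(1) z, of 0 "snd z"] by simp
qed

lemma dx_mult:
  "smooth_on U f \<Longrightarrow> smooth_on U g \<Longrightarrow> z \<in> U \<Longrightarrow>
    dx k (\<lambda>z. f z * g z) z = dx k f z * g z + f z * dx k g z"
  unfolding dx_eq_dirderiv by (rule dirderiv_mult)

lemma dy_mult:
  "smooth_on U f \<Longrightarrow> smooth_on U g \<Longrightarrow> z \<in> U \<Longrightarrow>
    dy k (\<lambda>z. f z * g z) z = dy k f z * g z + f z * dy k g z"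
  unfolding dy_eq_dirderiv by (rule dirderiv_mult)

end

section \<open>The spray as a derivation\<close>

definition spray_deriv :: "('n::finite xy \<Rightarrow> real ^ 'n) \<Rightarrow> ('n xy \<Rightarrow> real) \<Rightarrow> 'n xy \<Rightarrow> real" where
  "spray_deriv G f z = dirderiv (spray_field G z) f z"

text \<open>
  A spray in one chart. Smoothness and homogeneity are required of the components only, since all
  curvature quantities are built from them.
\<close>

locale local_spray = conical_domain U for U :: "'n::finite xy set" +
  fixes G :: "'n xy \<Rightarrow> real ^ 'n"
  assumes smooth_comp: "\<And>i. smooth_on U (comp G i)"
    and hom_comp: "\<And>i. pos_homogeneous 2 U (comp G i)"
begin

abbreviation S :: "('n xy \<Rightarrow> real) \<Rightarrow> 'n xy \<Rightarrow> real" where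
  "S \<equiv> spray_deriv G"

lemma spray_deriv_coordinates:
  assumes "smooth_on U f" "z \<in> U"
  shows "S f z = (\<Sum>i\<in>UNIV. ycoord i z * dx i f z) - 2 * (\<Sum>i\<in>UNIV. comp G i z * dy i f z)"
  using dirderiv_coordinates[OF assms, of "snd z" "- 2 *\<^sub>R G z"]
  by (simp add: spray_deriv_def spray_field_def comp_def sum_negf sum_distrib_left algebra_simps)

lemma smooth_spray_deriv:
  assumes "smooth_on U f"
  shows "smooth_on U (S f)"
  by (rule smooth_on_cong[OF open_U _ spray_deriv_coordinates[OF assms, symmetric]])
     (intro smooth_rules smooth_comp assms)+

lemma hom_spray_deriv:
  assumes "smooth_on U f" "pos_homogeneous (Suc r) U f"
  shows "pos_homogeneous (Suc (Suc r)) U (S f)"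
proof (rule hom_cong[OF _ spray_deriv_coordinates[OF assms(1), symmetric]])
  have "pos_homogeneous (1 + Suc r) U (\<lambda>z. ycoord i z * dx i f z)"
    "pos_homogeneous (2 + r) U (\<lambda>z. comp G i z * dy i f z)" for i
    by (intro hom_mult hom_ycoord hom_dx hom_dy hom_comp assms)+
  then show "pos_homogeneous (Suc (Suc r)) U (\<lambda>z. (\<Sum>i\<in>UNIV. ycoord i z * dx i f z)
      - 2 * (\<Sum>i\<in>UNIV. comp G i z * dy i f z))"
    by (intro hom_diff hom_cmult hom_sum) simp_all
qed

text \<open>
  The commutator of a constant vector field with the spray. It differentiates only the coefficients
  of the spray, because second derivatives of \<open>f\<close> commute.
\<close>

lemma dirderiv_spray_deriv:
  assumes f: "smooth_on U f" and z: "z \<in> U"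
  shows "dirderiv v (S f) z = S (dirderiv v f) z + (\<Sum>i\<in>UNIV. snd v $ i * dx i f z)
    - 2 * (\<Sum>i\<in>UNIV. dirderiv v (comp G i) z * dy i f z)"
proof -
  have c: "dirderiv v (dx i f) z = dx i (dirderiv v f) z"
    "dirderiv v (dy i f) z = dy i (dirderiv v f) z" for i
    unfolding dx_eq_dirderiv dy_eq_dirderiv by (rule dirderiv_commute[OF open_U z f])+
  have "dirderiv v (S f) z = dirderiv v (\<lambda>z. (\<Sum>i\<in>UNIV. ycoord i z * dx i f z)
      - 2 * (\<Sum>i\<in>UNIV. comp G i z * dy i f z)) z"
    by (rule dirderiv_cong[OF open_U z smooth_spray_deriv[OF f] spray_deriv_coordinates[OF f]])
  also have "\<dots> = (\<Sum>i\<in>UNIV. dirderiv v (\<lambda>z. ycoord i z * dx i f z) z)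
      - 2 * (\<Sum>i\<in>UNIV. dirderiv v (\<lambda>z. comp G i z * dy i f z) z)"
    by (subst dirderiv_diff[of U] dirderiv_mult[of U "\<lambda>_. 2"] dirderiv_const dirderiv_sum[of _ U],
        (intro smooth_rules smooth_comp f z)+)+ (simp add: dirderiv_const)
  also have "\<dots> = (\<Sum>i\<in>UNIV. snd v $ i * dx i f z + ycoord i z * dx i (dirderiv v f) z)
      - 2 * (\<Sum>i\<in>UNIV. dirderiv v (comp G i) z * dy i f z + comp G i z * dy i (dirderiv v f) z)"
  proof -
    have "dirderiv v (\<lambda>z. ycoord i z * dx i f z) z =
        snd v $ i * dx i f z + ycoord i z * dx i (dirderiv v f) z" for i
      by (subst dirderiv_mult[of U], (intro smooth_rules f z)+) (simp add: dirderiv_ycoord c)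
    moreover have "dirderiv v (\<lambda>z. comp G i z * dy i f z) z =
        dirderiv v (comp G i) z * dy i f z + comp G i z * dy i (dirderiv v f) z" for i
      by (subst dirderiv_mult[of U], (intro smooth_rules smooth_comp f z)+) (simp add: c)
    ultimately show ?thesis by simp
  qed
  finally show ?thesis
    using spray_deriv_coordinates[OF smooth_on_dirderiv[OF f] z, of v]
    by (simp add: sum.distrib algebra_simps)
qed

lemma dx_spray_deriv:
  assumes "smooth_on U f" "z \<in> U"
  shows "dx k (S f) z = S (dx k f) z - 2 * (\<Sum>i\<in>UNIV. dx k (comp G i) z * dy i f z)"
  using dirderiv_spray_deriv[OF assms, of "(axis k 1, 0)"] by (simp add: dx_eq_dirderiv)

lemma dy_spray_deriv:
  assumes "smooth_on U f" "z \<in> U"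
  shows "dy k (S f) z =
    S (dy k f) z + dx k f z - 2 * (\<Sum>i\<in>UNIV. dy k (comp G i) z * dy i f z)"
proof -
  have "(\<Sum>i\<in>UNIV. axis k 1 $ i * dx i f z) = dx k f z"
    by (simp add: axis_def if_distrib if_distribR cong: if_cong)
  then show ?thesis
    using dirderiv_spray_deriv[OF assms, of "(0, axis k 1)"] by (simp add: dy_eq_dirderiv)
qed

lemma hd_cov_eq: "hd_cov G k f z = dx k f z - (\<Sum>r\<in>UNIV. dy k (comp G r) z * dy r f z)"
  by (simp add: hd_cov_def spray_conn_def)

lemma euler_conn:
  assumes "z \<in> U"
  shows "(\<Sum>i\<in>UNIV. ycoord i z * dy i (comp G r) z) = 2 * comp G r z"
  using euler[OF smooth_comp hom_comp assms] by simp

lemma euler_berwald: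
  assumes "z \<in> U"
  shows "(\<Sum>j\<in>UNIV. ycoord j z * dy j (dy i (comp G r)) z) = dy i (comp G r) z"
  using euler[OF smooth_dy[OF smooth_comp] hom_dy[OF smooth_comp, of 1] assms] hom_comp
  by (simp add: numeral_2_eq_2)

text \<open>
  Contraction of \<open>f\<^sub>;\<^sub>i\<close> with \<open>y\<^sup>i\<close> turns \<open>G\<^sup>r\<^sub>i y\<^sup>i\<close> into \<open>2 G\<^sup>r\<close> by Euler's identity.
\<close>

lemma hd0_eq_spray_deriv:
  assumes "smooth_on U f" "z \<in> U"
  shows "hd0 G f z = S f z"
proof -
  have "hd0 G f z = (\<Sum>i\<in>UNIV. ycoord i z * dx i f z)
      - (\<Sum>i\<in>UNIV. \<Sum>r\<in>UNIV. ycoord i z * dy i (comp G r) z * dy r f z)"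
    by (simp add: hd0_def hd_cov_eq sum_subtractf left_diff_distrib right_diff_distrib
        sum_distrib_left mult_ac)
  also have "(\<Sum>i\<in>UNIV. \<Sum>r\<in>UNIV. ycoord i z * dy i (comp G r) z * dy r f z) =
      (\<Sum>r\<in>UNIV. (\<Sum>i\<in>UNIV. ycoord i z * dy i (comp G r) z) * dy r f z)"
    by (subst sum.swap) (simp add: sum_distrib_right)
  finally show ?thesis
    by (simp add: euler_conn[OF assms(2)] spray_deriv_coordinates[OF assms] sum_distrib_left mult_ac)
qed

text \<open>
  This rewrites the Hamel equation without the connection coefficients \<open>G\<^sup>r\<^sub>i\<^sub>j\<close>: those enter only
  through \<open>G\<^sup>r\<^sub>i\<^sub>j y\<^sup>j = G\<^sup>r\<^sub>i\<close>, and the rest is the commutator of the spray with \<open>\<partial>'\<^sub>k\<close>.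
\<close>

lemma vh0_eq:
  assumes "smooth_on U f" "z \<in> U"
  shows "vh0 G k f z = dy k (S f) z - hd_cov G k f z"
proof -
  have "vh0 G k f z = hd0 G (dy k f) z
      - (\<Sum>j\<in>UNIV. \<Sum>r\<in>UNIV. (ycoord j z * dy j (dy k (comp G r)) z) * dy r f z)"
    by (simp add: vh0_def vh_cov_def hd0_def berwald_conn_def sum_subtractf left_diff_distrib
        right_diff_distrib sum_distrib_left mult_ac)
  also have "(\<Sum>j\<in>UNIV. \<Sum>r\<in>UNIV. (ycoord j z * dy j (dy k (comp G r)) z) * dy r f z) =
      (\<Sum>r\<in>UNIV. (\<Sum>j\<in>UNIV. ycoord j z * dy j (dy k (comp G r)) z) * dy r f z)"
    by (subst sum.swap) (simp add: sum_distrib_right)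
  finally show ?thesis
    using hd0_eq_spray_deriv[OF smooth_dy[OF assms(1)] assms(2)] dy_spray_deriv[OF assms, of k]
    by (simp add: euler_berwald[OF assms(2)] hd_cov_eq)
qed

lemma riemann_eq:
  assumes "z \<in> U"
  shows "riemann G i k z = 2 * dx k (comp G i) z - S (dy k (comp G i)) z
    - (\<Sum>j\<in>UNIV. dy j (comp G i) z * dy k (comp G j) z)"
  by (simp add: riemann_def spray_deriv_coordinates[OF smooth_dy[OF smooth_comp] assms])

text \<open>
  Conceptually, \<open>R\<^sup>i\<^sub>k Q\<^sub>.\<^sub>i\<close> is a commutator of horizontal derivatives applied to \<open>Q\<close>, hence
  zero. Computationally, horizontal constancy gives \<open>\<partial>\<^sub>k Q = G\<^sup>r\<^sub>k Q\<^sub>.\<^sub>r\<close> and \<open>S Q = 0\<close>.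
  The commutators of \<open>S\<close> then express \<open>S (\<partial>\<^sub>k Q)\<close> by \<open>2 (\<partial>\<^sub>k G\<^sup>j) Q\<^sub>.\<^sub>j\<close>, and the product rule
  expresses it by the remaining terms of the curvature.
\<close>

lemma riemann_annihilates_parallel:
  assumes Q: "smooth_on U Q" and par: "\<And>k z. z \<in> U \<Longrightarrow> hd_cov G k Q z = 0" and z: "z \<in> U"
  shows "(\<Sum>i\<in>UNIV. riemann G i k z * dy i Q z) = 0"
proof -
  have dxQ: "dx k Q z = (\<Sum>r\<in>UNIV. dy k (comp G r) z * dy r Q z)" if "z \<in> U" for k z
    using par[OF that, of k] by (simp add: hd_cov_eq)
  have SQ: "S Q z = 0" if "z \<in> U" for z
    using hd0_eq_spray_deriv[OF Q that] par[OF that] by (simp add: hd0_def)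
  have 0: "dirderiv v (S Q) z = 0" for v
    using dirderiv_cong[OF open_U z smooth_spray_deriv[OF Q], of "\<lambda>_. 0" v] SQ
    by (simp add: dirderiv_const)
  have Sdx: "S (dx k Q) z = 2 * (\<Sum>i\<in>UNIV. dx k (comp G i) z * dy i Q z)"
    using dx_spray_deriv[OF Q z, of k] 0 by (simp add: dx_eq_dirderiv)
  have Sdy: "S (dy r Q) z = (\<Sum>i\<in>UNIV. dy r (comp G i) z * dy i Q z)" for r
    using dy_spray_deriv[OF Q z, of r] 0[of "(0, axis r 1)"] dxQ[OF z, of r]
    by (simp add: dy_eq_dirderiv)
  have "S (dx k Q) z = S (\<lambda>z. \<Sum>r\<in>UNIV. dy k (comp G r) z * dy r Q z) z"
    unfolding spray_deriv_def by (rule dirderiv_cong[OF open_U z smooth_dx[OF Q] dxQ])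
  also have "\<dots> = (\<Sum>r\<in>UNIV. S (\<lambda>z. dy k (comp G r) z * dy r Q z) z)"
    unfolding spray_deriv_def
    by (rule dirderiv_sum[of _ U]) (intro smooth_rules smooth_comp Q z)+
  also have "\<dots> = (\<Sum>r\<in>UNIV. S (dy k (comp G r)) z * dy r Q z
      + dy k (comp G r) z * (\<Sum>i\<in>UNIV. dy r (comp G i) z * dy i Q z))"
    unfolding Sdy[symmetric] unfolding spray_deriv_def
    by (intro sum.cong refl dirderiv_mult[of U] smooth_rules smooth_comp Q z)
  finally have "2 * (\<Sum>i\<in>UNIV. dx k (comp G i) z * dy i Q z) =
      (\<Sum>r\<in>UNIV. S (dy k (comp G r)) z * dy r Q z)
      + (\<Sum>r\<in>UNIV. \<Sum>i\<in>UNIV. dy k (comp G r) z * (dy r (comp G i) z * dy i Q z))"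
    by (simp add: Sdx sum.distrib sum_distrib_left)
  also have "(\<Sum>r\<in>UNIV. \<Sum>i\<in>UNIV. dy k (comp G r) z * (dy r (comp G i) z * dy i Q z)) =
      (\<Sum>i\<in>UNIV. (\<Sum>r\<in>UNIV. dy r (comp G i) z * dy k (comp G r) z) * dy i Q z)"
    by (subst sum.swap) (simp add: sum_distrib_right sum_distrib_left mult_ac)
  finally show ?thesis
    by (simp add: riemann_eq[OF z] left_diff_distrib right_diff_distrib sum_subtractf
        sum_distrib_left mult_ac)
qed

end

section \<open>Projective change\<close>

definition proj_change ::
    "('n::finite xy \<Rightarrow> real ^ 'n) \<Rightarrow> ('n xy \<Rightarrow> real) \<Rightarrow> 'n xy \<Rightarrow> real ^ 'n" where
  "proj_change G P z = G z + P z *\<^sub>R snd z"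

lemma comp_proj_change:
  "comp (proj_change G P) i = (\<lambda>z. comp G i z + P z * ycoord i z)"
  by (simp add: fun_eq_iff comp_def proj_change_def)

lemma dx_ycoord: "dx k (ycoord i) z = 0"
  by (simp add: dx_eq_dirderiv dirderiv_ycoord)

lemma dy_ycoord: "dy k (ycoord i) z = delta i k"
  by (simp add: dy_eq_dirderiv dirderiv_ycoord axis_def delta_def)

lemma delta_self: "delta i i = 1"
  by (simp add: delta_def)

lemma sum_delta_mult:
  fixes f :: "'n::finite \<Rightarrow> real"
  shows "(\<Sum>i\<in>UNIV. delta i k * f i) = f k" "(\<Sum>i\<in>UNIV. delta k i * f i) = f k"
    "(\<Sum>i\<in>UNIV. f i * delta i k) = f k" "(\<Sum>i\<in>UNIV. f i * delta k i) = f k"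
  by (simp_all add: delta_def if_distrib if_distribR cong: if_cong)

text \<open>
  The trace of the square of the matrix \<open>g + y p\<^sup>T + P I\<close>, where \<open>P = p\<^sup>T y\<close>: this is how the
  connection \<open>G\<^sup>i\<^sub>j\<close> changes under \<open>G\<^sup>i \<mapsto> G\<^sup>i + P y\<^sup>i\<close>.
\<close>

lemma trace_square_shift:
  fixes g :: "'n::finite \<Rightarrow> 'n \<Rightarrow> real" and p y :: "'n \<Rightarrow> real"
  assumes "(\<Sum>i\<in>UNIV. y i * p i) = P"
  shows "(\<Sum>i\<in>UNIV. \<Sum>j\<in>UNIV. (g i j + p j * y i + P * delta i j) * (g j i + p i * y j + P * delta j i))
    = (\<Sum>i\<in>UNIV. \<Sum>j\<in>UNIV. g i j * g j i) + 2 * (\<Sum>j\<in>UNIV. p j * (\<Sum>i\<in>UNIV. y i * g j i))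
      + 2 * P * (\<Sum>i\<in>UNIV. g i i) + (real CARD('n) + 3) * P\<^sup>2"
proof -
  have "(g i j + p j * y i + P * delta i j) * (g j i + p i * y j + P * delta j i)
    = g i j * g j i + p i * (y j * g i j) + p j * (y i * g j i) + (y i * p i) * (y j * p j)
      + P * (g i j * delta i j) + P * (g j i * delta i j)
      + P * (p i * y j * delta i j) + P * (p j * y i * delta i j) + P\<^sup>2 * (delta i j * delta i j)"
    for i j
    by (simp add: delta_def power2_eq_square algebra_simps)
  then have "(\<Sum>i\<in>UNIV. \<Sum>j\<in>UNIV. (g i j + p j * y i + P * delta i j) * (g j i + p i * y j + P * delta j i))
    = (\<Sum>i\<in>UNIV. \<Sum>j\<in>UNIV. g i j * g j i) + (\<Sum>i\<in>UNIV. p i * (\<Sum>j\<in>UNIV. y j * g i j))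
      + (\<Sum>i\<in>UNIV. \<Sum>j\<in>UNIV. p j * (y i * g j i)) + (\<Sum>i\<in>UNIV. y i * p i) * (\<Sum>j\<in>UNIV. y j * p j)
      + P * (\<Sum>i\<in>UNIV. g i i) + P * (\<Sum>i\<in>UNIV. g i i)
      + P * (\<Sum>i\<in>UNIV. p i * y i) + P * (\<Sum>i\<in>UNIV. p i * y i) + P\<^sup>2 * real CARD('n)"
    by (simp add: sum.distrib sum_delta_mult delta_self sum_product flip: sum_distrib_left)
  also have "(\<Sum>i\<in>UNIV. \<Sum>j\<in>UNIV. p j * (y i * g j i)) = (\<Sum>j\<in>UNIV. p j * (\<Sum>i\<in>UNIV. y i * g j i))"
    by (subst sum.swap) (simp add: sum_distrib_left)
  also have "(\<Sum>i\<in>UNIV. p i * y i) = P"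
    using assms by (simp add: mult.commute)
  finally show ?thesis
    using assms by (simp add: power2_eq_square algebra_simps)
qed

context local_spray
begin

text \<open>
  The derivative terms \<open>S (G\<^sup>i\<^sub>i)\<close> of the Ricci curvature involve the connection only through its
  trace, a function homogeneous of degree one. Working with this single function makes the
  projective change of the Ricci curvature a short computation.
\<close>

lemma smooth_conn_trace: "smooth_on U (\<lambda>z. \<Sum>i\<in>UNIV. dy i (comp G i) z)"
  by (intro smooth_rules smooth_comp)

lemma hom_conn_trace: "pos_homogeneous 1 U (\<lambda>z. \<Sum>i\<in>UNIV. dy i (comp G i) z)"
  using hom_comp by (intro hom_sum hom_dy smooth_comp) (simp add: numeral_2_eq_2)

lemma Ric_eq:
  assumes "z \<in> U"
  shows "Ric G z = 2 * (\<Sum>i\<in>UNIV. dx i (comp G i) z) - S (\<lambda>z. \<Sum>i\<in>UNIV. dy i (comp G i) z) z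
    - (\<Sum>i\<in>UNIV. \<Sum>j\<in>UNIV. dy j (comp G i) z * dy i (comp G j) z)"
proof -
  have "S (\<lambda>z. \<Sum>i\<in>UNIV. dy i (comp G i) z) z = (\<Sum>i\<in>UNIV. S (dy i (comp G i)) z)"
    unfolding spray_deriv_def by (rule dirderiv_sum[of _ U]) (intro smooth_rules smooth_comp assms)+
  then show ?thesis
    by (simp add: Ric_def riemann_eq[OF assms] sum_subtractf sum_distrib_left)
qed

lemma smooth_Ric: "smooth_on U (Ric G)"
  by (rule smooth_on_cong[OF open_U _ Ric_eq[symmetric]])
     (intro smooth_rules smooth_comp smooth_spray_deriv)+

lemma hom_Ric: "pos_homogeneous 2 U (Ric G)"
proof (rule hom_cong[OF _ Ric_eq[symmetric]])
  have "pos_homogeneous (Suc (Suc 0)) U (S (\<lambda>z. \<Sum>i\<in>UNIV. dy i (comp G i) z))"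
    using hom_conn_trace by (intro hom_spray_deriv smooth_conn_trace) simp
  moreover have "pos_homogeneous (1 + 1) U (\<lambda>z. dy j (comp G i) z * dy i (comp G j) z)" for i j
    using hom_comp by (intro hom_mult hom_dy smooth_comp) (simp_all add: numeral_2_eq_2)
  ultimately show "pos_homogeneous 2 U (\<lambda>z. 2 * (\<Sum>i\<in>UNIV. dx i (comp G i) z)
      - S (\<lambda>z. \<Sum>i\<in>UNIV. dy i (comp G i) z) z
      - (\<Sum>i\<in>UNIV. \<Sum>j\<in>UNIV. dy j (comp G i) z * dy i (comp G j) z))"
    by (intro hom_diff hom_cmult hom_sum hom_dx smooth_comp hom_comp)
       (simp_all add: numeral_2_eq_2)
qed

context
  fixes P :: "'n xy \<Rightarrow> real"
  assumes P: "smooth_on U P" "pos_homogeneous 1 U P"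
begin

lemma local_spray_proj_change: "local_spray U (proj_change G P)"
proof
  fix i
  show "smooth_on U (comp (proj_change G P) i)"
    unfolding comp_proj_change by (intro smooth_rules smooth_comp P)
  have "pos_homogeneous (1 + 1) U (\<lambda>z. P z * ycoord i z)"
    by (intro hom_mult hom_ycoord P)
  then show "pos_homogeneous 2 U (comp (proj_change G P) i)"
    unfolding comp_proj_change by (intro hom_add hom_comp) (simp add: numeral_2_eq_2)
qed

interpretation bar: local_spray U "proj_change G P"
  by (rule local_spray_proj_change)

lemma dx_proj_change:
  assumes "z \<in> U"
  shows "dx k (comp (proj_change G P) i) z = dx k (comp G i) z + dx k P z * ycoord i z"
proof -
  have "dx k (\<lambda>z. comp G i z + P z * ycoord i z) z =
      dx k (comp G i) z + dx k (\<lambda>z. P z * ycoord i z) z"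
    unfolding dx_eq_dirderiv
    by (rule dirderiv_add[of U]) (intro smooth_rules smooth_comp P assms)+
  also have "dx k (\<lambda>z. P z * ycoord i z) z = dx k P z * ycoord i z"
    by (subst dx_mult, (intro smooth_rules P assms)+) (simp add: dx_ycoord)
  finally show ?thesis by (simp add: comp_proj_change)
qed

lemma dy_proj_change:
  assumes "z \<in> U"
  shows "dy k (comp (proj_change G P) i) z =
    dy k (comp G i) z + dy k P z * ycoord i z + P z * delta i k"
proof -
  have "dy k (\<lambda>z. comp G i z + P z * ycoord i z) z =
      dy k (comp G i) z + dy k (\<lambda>z. P z * ycoord i z) z"
    unfolding dy_eq_dirderiv
    by (rule dirderiv_add[of U]) (intro smooth_rules smooth_comp P assms)+
  also have "dy k (\<lambda>z. P z * ycoord i z) z = dy k P z * ycoord i z + P z * delta i k"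
    by (subst dy_mult, (intro smooth_rules P assms)+) (simp add: dy_ycoord)
  finally show ?thesis by (simp add: comp_proj_change)
qed

text \<open>
  The change subtracts \<open>2 P y\<^sup>i \<partial>'\<^sub>i\<close>, which acts on homogeneous functions by their degree.
\<close>

lemma spray_deriv_proj_change:
  assumes f: "smooth_on U f" "pos_homogeneous r U f" and z: "z \<in> U"
  shows "spray_deriv (proj_change G P) f z = S f z - 2 * P z * (real r * f z)"
proof -
  have "(\<Sum>i\<in>UNIV. comp (proj_change G P) i z * dy i f z)
      = (\<Sum>i\<in>UNIV. comp G i z * dy i f z) + P z * (\<Sum>i\<in>UNIV. ycoord i z * dy i f z)"
    by (simp add: comp_proj_change distrib_right distrib_left sum.distrib sum_distrib_left mult_ac)
  also have "(\<Sum>i\<in>UNIV. ycoord i z * dy i f z) = real r * f z"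
    by (rule euler[OF f z])
  finally have "(\<Sum>i\<in>UNIV. comp (proj_change G P) i z * dy i f z)
      = (\<Sum>i\<in>UNIV. comp G i z * dy i f z) + P z * (real r * f z)" .
  then show ?thesis
    by (simp add: bar.spray_deriv_coordinates[OF f(1) z] spray_deriv_coordinates[OF f(1) z]
        distrib_left mult.assoc)
qed

text \<open>
  The trace of the connection changes by \<open>(n + 1) P\<close>. The terms linear in the connection cancel;
  \<open>2 S P\<close> from the \<open>x\<close>-derivatives and the square of the connection against \<open>- (n + 1) S P\<close> leaves
  \<open>- (n - 1) S P\<close>, and \<open>2 (n + 1) P\<^sup>2 - (n + 3) P\<^sup>2\<close> leaves \<open>(n - 1) P\<^sup>2\<close>.
\<close>

lemma Ric_proj_change:
  assumes z: "z \<in> U"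
  shows "Ric (proj_change G P) z = Ric G z + (real CARD('n) - 1) * ((P z)\<^sup>2 - S P z)"
proof -
  let ?n = "real CARD('n)"
  let ?t = "\<lambda>z. \<Sum>i\<in>UNIV. dy i (comp G i) z"
  let ?tb = "\<lambda>z. \<Sum>i\<in>UNIV. dy i (comp (proj_change G P) i) z"
  have eP: "(\<Sum>i\<in>UNIV. ycoord i z * dy i P z) = P z" if "z \<in> U" for z
    using euler[OF P that] by simp
  have tb: "?tb z = ?t z + (?n + 1) * P z" if "z \<in> U" for z
    using eP[OF that]
    by (simp add: dy_proj_change[OF that] sum.distrib delta_def mult.commute algebra_simps)
  have "S ?tb z = S (\<lambda>z. ?t z + (?n + 1) * P z) z"
    unfolding spray_deriv_def by (rule dirderiv_cong[OF open_U z bar.smooth_conn_trace tb])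
  also have "\<dots> = S ?t z + (?n + 1) * S P z"
  proof -
    have "S (\<lambda>z. ?t z + (?n + 1) * P z) z = S ?t z + S (\<lambda>z. (?n + 1) * P z) z"
      unfolding spray_deriv_def
      by (rule dirderiv_add[of U]) (intro smooth_rules smooth_comp P z)+
    moreover have "S (\<lambda>z. (?n + 1) * P z) z = (?n + 1) * S P z"
      unfolding spray_deriv_def
      by (subst dirderiv_mult[of U], (intro smooth_rules P z)+) (simp add: dirderiv_const)
    ultimately show ?thesis by simp
  qed
  finally have 1: "spray_deriv (proj_change G P) ?tb z =
      S ?t z + (?n + 1) * S P z - 2 * P z * (?t z + (?n + 1) * P z)"
    using spray_deriv_proj_change[OF bar.smooth_conn_trace bar.hom_conn_trace z] tb[OF z] by simp
  have 2: "(\<Sum>i\<in>UNIV. dx i (comp (proj_change G P) i) z) =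
      (\<Sum>i\<in>UNIV. dx i (comp G i) z) + (\<Sum>i\<in>UNIV. ycoord i z * dx i P z)"
    by (simp add: dx_proj_change[OF z] sum.distrib mult.commute)
  have 3: "(\<Sum>i\<in>UNIV. \<Sum>j\<in>UNIV. dy j (comp (proj_change G P) i) z * dy i (comp (proj_change G P) j) z)
      = (\<Sum>i\<in>UNIV. \<Sum>j\<in>UNIV. dy j (comp G i) z * dy i (comp G j) z)
        + 2 * (2 * (\<Sum>i\<in>UNIV. comp G i z * dy i P z)) + 2 * P z * ?t z + (?n + 3) * (P z)\<^sup>2"
  proof -
    have "(\<Sum>j\<in>UNIV. dy j P z * (\<Sum>i\<in>UNIV. ycoord i z * dy i (comp G j) z))
        = 2 * (\<Sum>i\<in>UNIV. comp G i z * dy i P z)"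
      by (simp add: euler_conn[OF z] sum_distrib_left mult_ac)
    then show ?thesis
      unfolding dy_proj_change[OF z]
      using trace_square_shift[of "\<lambda>i. ycoord i z" "\<lambda>i. dy i P z" "P z"
          "\<lambda>i j. dy j (comp G i) z", OF eP[OF z]]
      by simp
  qed
  show ?thesis
    unfolding bar.Ric_eq[OF z] Ric_eq[OF z] 1 2 3
    using spray_deriv_coordinates[OF P(1) z]
    by (simp add: power2_eq_square algebra_simps)
qed

end

section \<open>Hamel functions\<close>

lemma proj_factor_eq: "proj_factor G Q = (\<lambda>z. hd0 G Q z / (2 * Q z))"
  by (simp add: fun_eq_iff proj_factor_def)

lemma smooth_hd0: "smooth_on U f \<Longrightarrow> smooth_on U (hd0 G f)"
  by (rule smooth_on_cong[OF open_U smooth_spray_deriv hd0_eq_spray_deriv[symmetric]])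

lemma hom_hd0:
  "smooth_on U f \<Longrightarrow> pos_homogeneous (Suc r) U f \<Longrightarrow> pos_homogeneous (Suc (Suc r)) U (hd0 G f)"
  by (rule hom_cong[OF hom_spray_deriv hd0_eq_spray_deriv[symmetric]])

context
  fixes Q :: "'n xy \<Rightarrow> real"
  assumes Q: "smooth_on U Q" "pos_homogeneous 1 U Q" "\<And>z. z \<in> U \<Longrightarrow> Q z \<noteq> 0"
begin

abbreviation P :: "'n xy \<Rightarrow> real" where
  "P \<equiv> proj_factor G Q"

lemma smooth_proj_factor: "smooth_on U P"
  unfolding proj_factor_eq
  by (rule smooth_on_divide[OF open_U smooth_hd0[OF Q(1)]]) (simp_all add: smooth_rules Q)

lemma hom_proj_factor: "pos_homogeneous 1 U P"
  unfolding proj_factor_eq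
  using hom_hd0[OF Q(1), of 0] Q(2) by (intro hom_divide[of _ 1] hom_cmult) simp_all

text \<open>
  This function is \<open>\<lambda> Q\<^sup>2\<close>, the coefficient of \<open>\<delta>\<^sup>i\<^sub>k\<close> in the curvature of the changed spray. Its
  smoothness and homogeneity turn the asserted form of the curvature into scalar curvature.
\<close>

lemma smooth_scalar_numerator:
  "smooth_on U (\<lambda>z. ricci_scalar G z + (P z)\<^sup>2 - hd0 G P z)"
  unfolding ricci_scalar_def power2_eq_square divide_inverse
  by (intro smooth_rules smooth_Ric smooth_hd0 smooth_proj_factor)

lemma hom_scalar_numerator:
  "pos_homogeneous 2 U (\<lambda>z. ricci_scalar G z + (P z)\<^sup>2 - hd0 G P z)"
proof -
  have 1: "pos_homogeneous 2 U (\<lambda>z. P z * P z)"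
    using hom_mult[OF hom_proj_factor hom_proj_factor] by (simp add: numeral_2_eq_2)
  have 2: "pos_homogeneous 2 U (hd0 G P)"
    using hom_hd0[OF smooth_proj_factor, of 0] hom_proj_factor by (simp add: numeral_2_eq_2)
  have 3: "pos_homogeneous 2 U (\<lambda>z. Ric G z * inverse (real CARD('n) - 1))"
    using hom_cmult[OF hom_Ric, of "inverse (real CARD('n) - 1)"] by (simp add: mult.commute)
  show ?thesis
    unfolding ricci_scalar_def power2_eq_square divide_inverse
    by (intro hom_diff hom_add 1 2 3)
qed

text \<open>
  By \<open>vh0_eq\<close> the Hamel equation reads \<open>2 Q\<^sub>;\<^sub>k = (S Q)\<^sub>.\<^sub>k\<close>, and \<open>S Q = 2 P Q\<close> by the choice of \<open>P\<close>,
  so \<open>Q\<^sub>;\<^sub>k = P\<^sub>.\<^sub>k Q + P Q\<^sub>.\<^sub>k\<close>. The projective change by \<open>P\<close> subtracts exactly this from \<open>Q\<^sub>;\<^sub>k\<close>.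
\<close>

lemma hamel_parallel:
  assumes hamel: "\<And>z k. z \<in> U \<Longrightarrow> hd_cov G k Q z = vh0 G k Q z" and z: "z \<in> U"
  shows "hd_cov (proj_change G P) k Q z = 0"
proof -
  note PP = smooth_proj_factor hom_proj_factor
  interpret bar: local_spray U "proj_change G P"
    by (rule local_spray_proj_change[OF PP])
  have SQ: "S Q z = 2 * (P z * Q z)" if "z \<in> U" for z
    using Q(3)[OF that] hd0_eq_spray_deriv[OF Q(1) that] by (simp add: proj_factor_def)
  have "2 * hd_cov G k Q z = dy k (S Q) z"
    using hamel[OF z, of k] vh0_eq[OF Q(1) z, of k] by simp
  also have "\<dots> = dy k (\<lambda>z. 2 * (P z * Q z)) z"
    unfolding dy_eq_dirderiv by (rule dirderiv_cong[OF open_U z smooth_spray_deriv[OF Q(1)] SQ])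
  also have "\<dots> = 2 * (dy k P z * Q z + P z * dy k Q z)"
    by (subst dy_mult dy_mult, (intro smooth_rules PP Q(1) z)+)+
       (simp add: dy_eq_dirderiv dirderiv_const)
  finally have 1: "hd_cov G k Q z = dy k P z * Q z + P z * dy k Q z" by simp
  have "(\<Sum>r\<in>UNIV. dy k (comp (proj_change G P) r) z * dy r Q z) =
      (\<Sum>r\<in>UNIV. dy k (comp G r) z * dy r Q z) + dy k P z * (\<Sum>r\<in>UNIV. ycoord r z * dy r Q z)
      + P z * (\<Sum>r\<in>UNIV. delta r k * dy r Q z)"
    by (simp add: dy_proj_change[OF PP z] distrib_right distrib_left sum.distrib sum_distrib_left mult_ac)
  also have "\<dots> = (\<Sum>r\<in>UNIV. dy k (comp G r) z * dy r Q z) + dy k P z * Q z + P z * dy k Q z"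
    using euler[OF Q(1,2) z] by (simp add: sum_delta_mult)
  finally show ?thesis
    using 1 by (simp add: hd_cov_eq bar.hd_cov_eq)
qed

text \<open>
  Contracting the form of the curvature with \<open>Q\<^sub>.\<^sub>i\<close> gives \<open>0 = R Q\<^sub>.\<^sub>k - \<tau>\<^sub>k Q\<close>. Then
  \<open>\<tau>\<^sub>k y\<^sup>k = R\<close>, so the trace of the curvature is \<open>(n - 1) R\<close>, which is computed by
  \<open>Ric_proj_change\<close>.
\<close>

lemma scalar_curvature_coefficients:
  assumes hamel: "\<And>z k. z \<in> U \<Longrightarrow> hd_cov G k Q z = vh0 G k Q z" and z: "z \<in> U"
    and n: "CARD('n) \<ge> 2"
    and form: "\<And>i k. riemann (proj_change G P) i k z = R * delta i k - \<tau> k * ycoord i z"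
  shows "R = ricci_scalar G z + (P z)\<^sup>2 - hd0 G P z" "\<tau> k = R * dy k Q z / Q z"
proof -
  note PP = smooth_proj_factor hom_proj_factor
  interpret bar: local_spray U "proj_change G P"
    by (rule local_spray_proj_change[OF PP])
  have eQ: "(\<Sum>i\<in>UNIV. ycoord i z * dy i Q z) = Q z"
    using euler[OF Q(1,2) z] by simp
  have tau: "\<tau> k = R * dy k Q z / Q z" for k
  proof -
    have "0 = (\<Sum>i\<in>UNIV. riemann (proj_change G P) i k z * dy i Q z)"
      by (rule bar.riemann_annihilates_parallel[OF Q(1) hamel_parallel[OF hamel] z, symmetric])
    also have "\<dots> = R * (\<Sum>i\<in>UNIV. delta i k * dy i Q z)
        - \<tau> k * (\<Sum>i\<in>UNIV. ycoord i z * dy i Q z)"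
      by (simp add: form left_diff_distrib right_diff_distrib sum_subtractf sum_distrib_left mult_ac)
    also have "\<dots> = R * dy k Q z - \<tau> k * Q z"
      by (simp only: sum_delta_mult eQ)
    finally show ?thesis
      using Q(3)[OF z] by (simp add: field_simps)
  qed
  then show "\<tau> k = R * dy k Q z / Q z" .
  have "(\<Sum>i\<in>UNIV. \<tau> i * ycoord i z) = R / Q z * (\<Sum>i\<in>UNIV. ycoord i z * dy i Q z)"
    by (simp add: tau sum_distrib_left mult_ac)
  then have "(\<Sum>i\<in>UNIV. \<tau> i * ycoord i z) = R"
    using Q(3)[OF z] by (simp add: eQ)
  then have "Ric (proj_change G P) z = (real CARD('n) - 1) * R"
    by (simp add: Ric_def form sum_subtractf delta_def algebra_simps)
  then have "(real CARD('n) - 1) * R = Ric G z + (real CARD('n) - 1) * ((P z)\<^sup>2 - S P z)"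
    by (simp add: Ric_proj_change[OF PP z])
  moreover have "real CARD('n) - 1 \<noteq> 0" using n by simp
  ultimately show "R = ricci_scalar G z + (P z)\<^sup>2 - hd0 G P z"
    unfolding ricci_scalar_def hd0_eq_spray_deriv[OF PP(1) z] by (simp add: field_simps)
qed

section \<open>Funk functions\<close>

text \<open>
  Contracting the Funk equation with \<open>y\<^sup>k\<close> gives \<open>S Q = Q\<^sup>2\<close>, from which everything about
  \<open>P = S Q / (2 Q)\<close> follows. The Hamel equation holds because \<open>(S Q)\<^sub>.\<^sub>k = 2 Q Q\<^sub>.\<^sub>k\<close> is twice the
  Funk equation.
\<close>

lemma
  assumes funk: "\<And>z k. z \<in> U \<Longrightarrow> hd_cov G k Q z = Q z * dy k Q z" and z: "z \<in> U"
  shows funk_imp_hamel: "hd_cov G k Q z = vh0 G k Q z"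
    and funk_proj_factor: "P z = Q z / 2"
    and funk_hd0_proj_factor: "hd0 G P z = (Q z)\<^sup>2 / 2"
proof -
  have hd0: "hd0 G Q z = (Q z)\<^sup>2" if "z \<in> U" for z
  proof -
    have "hd0 G Q z = Q z * (\<Sum>i\<in>UNIV. ycoord i z * dy i Q z)"
      by (simp add: hd0_def funk[OF that] sum_distrib_left mult_ac)
    then show ?thesis using euler[OF Q(1,2) that] by (simp add: power2_eq_square)
  qed
  have SQ: "S Q z = Q z * Q z" if "z \<in> U" for z
    using hd0[OF that] hd0_eq_spray_deriv[OF Q(1) that] by (simp add: power2_eq_square)
  have "dy k (S Q) z = dy k (\<lambda>z. Q z * Q z) z"
    unfolding dy_eq_dirderiv by (rule dirderiv_cong[OF open_U z smooth_spray_deriv[OF Q(1)] SQ])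
  also have "\<dots> = 2 * (Q z * dy k Q z)"
    by (simp add: dy_mult[OF Q(1,1) z])
  finally show "hd_cov G k Q z = vh0 G k Q z"
    by (simp add: vh0_eq[OF Q(1) z] funk[OF z])
  have P: "P z = (1 / 2) * Q z" if "z \<in> U" for z
    using hd0[OF that] Q(3)[OF that] by (simp add: proj_factor_def power2_eq_square)
  then show "P z = Q z / 2" using z by simp
  have "hd0 G P z = S (\<lambda>z. (1 / 2) * Q z) z"
    unfolding hd0_eq_spray_deriv[OF smooth_proj_factor z] spray_deriv_def
    by (rule dirderiv_cong[OF open_U z smooth_proj_factor P])
  also have "\<dots> = (1 / 2) * S Q z"
    unfolding spray_deriv_def
    by (subst dirderiv_mult[of U], (intro smooth_rules Q(1) z)+) (simp add: dirderiv_const)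
  finally show "hd0 G P z = (Q z)\<^sup>2 / 2"
    using SQ[OF z] by (simp add: power2_eq_square)
qed

end

end

section \<open>Functions constant on the fibres\<close>

context conical_domain
begin

lemma open_fibre: "open {v. (x, v) \<in> U}"
proof -
  have "open ((\<lambda>v. (x, v)) -` U)"
    by (intro open_vimage open_U continuous_intros)
  then show ?thesis by (simp add: vimage_def)
qed

text \<open>
  The fibres are open, hence so are their components: on such a component a function with vanishing
  gradient is constant, and a function that is constant there is constant near each point.
\<close>

lemma fibre_constant_iff:
  assumes f: "smooth_on U f"
  shows "(\<forall>x y y'. connected_component {v. (x, v) \<in> U} y y' \<longrightarrow> f (x, y) = f (x, y'))
    \<longleftrightarrow> (\<forall>z\<in>U. \<forall>k. dy k f z = 0)"
proof safe
  fix x y k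
  assume const: "\<forall>x y y'. connected_component {v. (x, v) \<in> U} y y' \<longrightarrow> f (x, y) = f (x, y')"
    and xy: "(x, y) \<in> U"
  obtain e where e: "e > 0" "ball y e \<subseteq> {v. (x, v) \<in> U}"
    using open_fibre xy openE by blast
  have eq: "f (x, y) = f (x, v)" if "v \<in> ball y e" for v
    using const that e unfolding connected_component_def
    by (meson centre_in_ball connected_ball)
  have "((\<lambda>v. (x, v)) has_derivative (\<lambda>v. (0, v))) (at y)"
    by (auto intro!: derivative_eq_intros)
  from has_derivative_compose[OF this, of f "frechet_derivative f (at (x, y))"]
  have 1: "((\<lambda>v. f (x, v)) has_derivative (\<lambda>v. frechet_derivative f (at (x, y)) (0, v))) (at y)"
    using smooth_on_has_derivative[OF f xy] by simp
  have 2: "((\<lambda>v. f (x, v)) has_derivative (\<lambda>v. 0)) (at y)"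
    by (rule has_derivative_transform_within_open[of "\<lambda>_. f (x, y)" _ _ _ "ball y e"])
       (use e eq in auto)
  show "dy k f (x, y) = 0"
    using fun_cong[OF has_derivative_unique[OF 1 2], of "axis k 1"] by (simp add: dy_def)
next
  fix x y y'
  assume zero: "\<forall>z\<in>U. \<forall>k. dy k f z = 0" and cc: "connected_component {v. (x, v) \<in> U} y y'"
  let ?C = "connected_component_set {v. (x, v) \<in> U} y"
  have der: "((\<lambda>v. f (x, v)) has_derivative (\<lambda>_. 0)) (at v)" if "v \<in> ?C" for v
  proof -
    have v: "(x, v) \<in> U" using that connected_component_in by fastforce
    have "((\<lambda>v. (x, v)) has_derivative (\<lambda>v. (0, v))) (at v)"
      by (auto intro!: derivative_eq_intros)
    from has_derivative_compose[OF this, of f "frechet_derivative f (at (x, v))"]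
    have "((\<lambda>v. f (x, v)) has_derivative (\<lambda>w. frechet_derivative f (at (x, v)) (0, w))) (at v)"
      using smooth_on_has_derivative[OF f v] by simp
    moreover have "frechet_derivative f (at (x, v)) (0, w) = 0" for w
      using dirderiv_coordinates[OF f v, of 0 w] zero v by (simp add: dirderiv_def)
    ultimately show ?thesis by simp
  qed
  have "y \<in> ?C" "y' \<in> ?C"
    using cc connected_component_in connected_component_refl by fastforce+
  then show "f (x, y) = f (x, y')"
    using has_derivative_zero_unique_connected[of ?C "\<lambda>v. f (x, v)"] der
      open_connected_component[OF open_fibre] connected_connected_component
    by metis
qed

end

section \<open>Hamel and Funk sprays of scalar and isotropic curvature\<close>

lemma local_spray_chart:
  assumes A: "conical_region A D" "spray A D G" and c: "c \<in> A"
  shows "local_spray (D c) (G c)"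
proof
  have con: "open (D c)" "\<forall>(x, y)\<in>D c. \<forall>t>0. (x, t *\<^sub>R y) \<in> D c"
    using A(1) c unfolding conical_region_def by blast+
  then show "open (D c)" by simp
  show "(fst z, t *\<^sub>R snd z) \<in> D c" if "z \<in> D c" "t > 0" for z t
    using con(2) that by (cases z) auto
  have G: "smooth_on (D c) (G c)" "pos_homogeneous 2 (D c) (G c)"
    using A(2) c unfolding spray_def by blast+
  show "smooth_on (D c) (comp (G c) i)" for i
    using smooth_on_bounded_linear[OF con(1) bounded_linear_vec_nth G(1)]
    by (simp add: comp_def[abs_def])
  show "pos_homogeneous 2 (D c) (comp (G c) i)" for i
    using G(2) by (auto simp: pos_homogeneous_def comp_def)
qed

theorem theorem6p8:
  fixes A :: "('m::{t2_space, second_countable_topology}, 'n::finite) chart set"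
    and D :: "('m, 'n) chart \<Rightarrow> 'n xy set"
    and G :: "('m, 'n) chart \<Rightarrow> 'n xy \<Rightarrow> real ^ 'n"
    and Q :: "('m, 'n) chart \<Rightarrow> 'n xy \<Rightarrow> real"
  assumes "CARD('n) \<ge> 2"
    and "smooth_atlas A"
    and "conical_region A D"
    and "spray A D G"
    and "nonvanishing A D Q"
  shows
    "(hamel_function A D G Q \<longrightarrow>
       (scalar_curvature A D (hamel_spray G Q) \<longleftrightarrow>
        riemann_form A D (hamel_spray G Q) Q
          (\<lambda>c z. (ricci_scalar (G c) z + (proj_factor (G c) (Q c) z)\<^sup>2
                    - hd0 (G c) (proj_factor (G c) (Q c)) z) / (Q c z)\<^sup>2)))
     \<and>
     (funk_function A D G Q \<longrightarrow>
       (isotropic_curvature A D (hamel_spray G Q) \<longleftrightarrow>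
        riemann_form A D (hamel_spray G Q) Q
          (\<lambda>c z. ricci_scalar (G c) z / (Q c z)\<^sup>2 - 1 / 4) \<and>
        depends_on_position A D (\<lambda>c z. ricci_scalar (G c) z / (Q c z)\<^sup>2 - 1 / 4)))"
proof -
  define P where "P = (\<lambda>c. proj_factor (G c) (Q c))"
  define R where "R = (\<lambda>c z. ricci_scalar (G c) z + (P c z)\<^sup>2 - hd0 (G c) (P c) z)"
  define \<tau> where "\<tau> = (\<lambda>c k z. R c z * dy k (Q c) z / Q c z)"
  define lam where "lam = (\<lambda>c z. R c z / (Q c z)\<^sup>2)"
  have bar: "hamel_spray G Q c = proj_change (G c) (P c)" for c
    by (simp add: fun_eq_iff hamel_spray_def proj_change_def P_def)
  have loc: "local_spray (D c) (G c)" if "c \<in> A" for c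
    by (rule local_spray_chart[OF assms(3,4) that])
  have nz: "Q c z \<noteq> 0" if "c \<in> A" "z \<in> D c" for c z
    using assms(5) that by (auto simp: nonvanishing_def)
  \<comment> \<open>\<open>\<lambda> Q\<^sup>2 = R\<close> and \<open>\<lambda> Q Q\<^sub>.\<^sub>k = \<tau>\<^sub>k\<close> as \<open>Q\<close> has no zeros\<close>
  have form_iff: "riemann_form A D (hamel_spray G Q) Q lam \<longleftrightarrow>
      (\<forall>c\<in>A. \<forall>z\<in>D c. \<forall>i k.
        riemann (hamel_spray G Q c) i k z = R c z * delta i k - \<tau> c k z * snd z $ i)"
    unfolding riemann_form_def
    by (intro ball_cong refl all_cong1 arg_cong2[where f = "(=)"])
       (use nz in \<open>simp add: lam_def \<tau>_def power2_eq_square field_simps\<close>)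
  have scalar: "scalar_curvature_with A D (hamel_spray G Q) R \<tau> \<longleftrightarrow>
      riemann_form A D (hamel_spray G Q) Q lam"
    and unique: "scalar_curvature_with A D (hamel_spray G Q) R' \<tau>' \<Longrightarrow>
      c \<in> A \<Longrightarrow> z \<in> D c \<Longrightarrow> R' c z = R c z \<and> \<tau>' c k z = \<tau> c k z"
    and smooth_R: "c \<in> A \<Longrightarrow> smooth_on (D c) (R c)"
    if H: "hamel_function A D G Q" for R' \<tau>' c z k
  proof -
    have Q: "smooth_on (D c) (Q c)" "pos_homogeneous 1 (D c) (Q c)"
      "\<And>z. z \<in> D c \<Longrightarrow> Q c z \<noteq> 0"
      and hamel: "\<And>z k. z \<in> D c \<Longrightarrow> hd_cov (G c) k (Q c) z = vh0 (G c) k (Q c) z"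
      if "c \<in> A" for c
      using H that nz unfolding hamel_function_def smooth_function_def by blast+
    note R_def' = R_def P_def
    show sR: "smooth_on (D c) (R c)" if "c \<in> A" for c
      using local_spray.smooth_scalar_numerator[OF loc[OF that] Q[OF that]] by (simp add: R_def')
    have hR: "pos_homogeneous 2 (D c) (R c)" if "c \<in> A" for c
      using local_spray.hom_scalar_numerator[OF loc[OF that] Q[OF that]] by (simp add: R_def')
    have "smooth_on (D c) (\<tau> c k) \<and> pos_homogeneous 1 (D c) (\<tau> c k)" if c: "c \<in> A" for c k
    proof -
      interpret local_spray "D c" "G c" by (rule loc[OF c])
      have "pos_homogeneous (2 + 0) (D c) (\<lambda>z. R c z * dy k (Q c) z)"
        using Q(2)[OF c] by (intro hom_mult hR hom_dy Q(1) c) simp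
      then have "pos_homogeneous 1 (D c) (\<tau> c k)"
        unfolding \<tau>_def using Q(2)[OF c]
        by (intro hom_divide[of _ 1]) (simp_all add: numeral_2_eq_2)
      moreover have "smooth_on (D c) (\<tau> c k)"
        unfolding \<tau>_def using Q(3)[OF c]
        by (intro smooth_on_divide[OF open_U] smooth_rules sR Q(1) c)
      ultimately show ?thesis by simp
    qed
    then show "scalar_curvature_with A D (hamel_spray G Q) R \<tau> \<longleftrightarrow>
        riemann_form A D (hamel_spray G Q) Q lam"
      unfolding form_iff scalar_curvature_with_def using sR hR by blast
    assume w: "scalar_curvature_with A D (hamel_spray G Q) R' \<tau>'" and c: "c \<in> A" and z: "z \<in> D c"
    have f: "riemann (proj_change (G c) (P c)) i k z = R' c z * delta i k - \<tau>' c k z * snd z $ i"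
      for i k
      using w c z unfolding scalar_curvature_with_def bar by blast
    show "R' c z = R c z \<and> \<tau>' c k z = \<tau> c k z"
      using local_spray.scalar_curvature_coefficients[OF loc[OF c] Q[OF c] hamel[OF c] z assms(1)
          f[unfolded P_def]]
      by (simp add: R_def' \<tau>_def)
  qed
  have hamel_part: "scalar_curvature A D (hamel_spray G Q) \<longleftrightarrow>
      riemann_form A D (hamel_spray G Q) Q lam" if H: "hamel_function A D G Q"
  proof
    assume "scalar_curvature A D (hamel_spray G Q)"
    then obtain R' \<tau>' where w: "scalar_curvature_with A D (hamel_spray G Q) R' \<tau>'"
      unfolding scalar_curvature_def by blast
    then show "riemann_form A D (hamel_spray G Q) Q lam"
      using unique[OF H w] unfolding form_iff scalar_curvature_with_def by simp
  qed (use scalar[OF H] in \<open>auto simp: scalar_curvature_def\<close>)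
  have funk_part: "isotropic_curvature A D (hamel_spray G Q) \<longleftrightarrow>
      riemann_form A D (hamel_spray G Q) Q (\<lambda>c z. ricci_scalar (G c) z / (Q c z)\<^sup>2 - 1 / 4) \<and>
      depends_on_position A D (\<lambda>c z. ricci_scalar (G c) z / (Q c z)\<^sup>2 - 1 / 4)"
    if F: "funk_function A D G Q"
  proof -
    have Q: "smooth_on (D c) (Q c)" "pos_homogeneous 1 (D c) (Q c)"
      "\<And>z. z \<in> D c \<Longrightarrow> Q c z \<noteq> 0"
      and funk: "\<And>z k. z \<in> D c \<Longrightarrow> hd_cov (G c) k (Q c) z = Q c z * dy k (Q c) z"
      if "c \<in> A" for c
      using F that nz unfolding funk_function_def smooth_function_def by blast+
    have H: "hamel_function A D G Q"
      using F local_spray.funk_imp_hamel[OF loc Q funk]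
      unfolding hamel_function_def funk_function_def by blast
    have lam_eq: "ricci_scalar (G c) z / (Q c z)\<^sup>2 - 1 / 4 = lam c z"
      if c: "c \<in> A" and z: "z \<in> D c" for c z
    proof -
      have "proj_factor (G c) (Q c) z = Q c z / 2"
        using local_spray.funk_proj_factor[OF loc Q funk] c z by blast
      moreover have "hd0 (G c) (proj_factor (G c) (Q c)) z = (Q c z)\<^sup>2 / 2"
        using local_spray.funk_hd0_proj_factor[OF loc Q funk] c z by blast
      ultimately have "R c z = ricci_scalar (G c) z + (Q c z / 2)\<^sup>2 - (Q c z)\<^sup>2 / 2"
        by (simp only: R_def P_def)
      then have "R c z = ricci_scalar (G c) z - (1 / 4) * (Q c z)\<^sup>2"
        by (simp add: power2_eq_square)
      then show ?thesis
        using nz[OF c z] by (simp add: lam_def diff_divide_distrib)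
    qed
    have smooth_lam: "smooth_on (D c) (lam c)" if "c \<in> A" for c
    proof -
      interpret local_spray "D c" "G c" by (rule loc[OF that])
      show ?thesis
        unfolding lam_def power2_eq_square using Q[OF that] smooth_R[OF H that]
        by (intro smooth_on_divide[OF open_U] smooth_rules) simp_all
    qed
    \<comment> \<open>\<open>(\<lambda> Q\<^sup>2)\<^sub>.\<^sub>k = \<lambda>\<^sub>.\<^sub>k Q\<^sup>2 + 2 \<tau>\<^sub>k\<close>\<close>
    have dyR: "dy k (R c) z = 2 * \<tau> c k z \<longleftrightarrow> dy k (lam c) z = 0"
      if c: "c \<in> A" and z: "z \<in> D c" for c z k
    proof -
      interpret local_spray "D c" "G c" by (rule loc[OF c])
      have RQ: "R c z = lam c z * (Q c z * Q c z)" if "z \<in> D c" for z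
        using nz[OF c that] by (simp add: lam_def power2_eq_square)
      have "dy k (R c) z = dy k (\<lambda>z. lam c z * (Q c z * Q c z)) z"
        unfolding dy_eq_dirderiv by (rule dirderiv_cong[OF open_U z smooth_R[OF H c] RQ])
      also have "\<dots> = dy k (lam c) z * (Q c z * Q c z) + lam c z * (2 * (Q c z * dy k (Q c) z))"
        using smooth_on_mult[OF open_U Q(1)[OF c] Q(1)[OF c]]
        by (simp add: dy_mult smooth_lam Q(1) c z)
      also have "lam c z * (2 * (Q c z * dy k (Q c) z)) = 2 * \<tau> c k z"
        using nz[OF c z] by (simp add: \<tau>_def RQ[OF z])
      finally show ?thesis using nz[OF c z] by simp
    qed
    have iso: "isotropic_curvature A D (hamel_spray G Q) \<longleftrightarrow>
        riemann_form A D (hamel_spray G Q) Q lam \<and> (\<forall>c\<in>A. \<forall>z\<in>D c. \<forall>k. dy k (lam c) z = 0)"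
    proof
      assume "isotropic_curvature A D (hamel_spray G Q)"
      then obtain R' \<tau>' where w: "scalar_curvature_with A D (hamel_spray G Q) R' \<tau>'"
        and i: "\<And>c z k. c \<in> A \<Longrightarrow> z \<in> D c \<Longrightarrow> dy k (R' c) z = 2 * \<tau>' c k z"
        unfolding isotropic_curvature_def by blast
      have "dy k (lam c) z = 0" if c: "c \<in> A" and z: "z \<in> D c" for c z k
      proof -
        interpret local_spray "D c" "G c" by (rule loc[OF c])
        \<comment> \<open>\<open>R c\<close> and \<open>R' c\<close> agree on the open set \<open>D c\<close>, so their derivatives agree there too\<close>
        have "dy k (R c) z = dy k (R' c) z"
          unfolding dy_eq_dirderiv using unique[OF H w c]
          by (intro dirderiv_cong[OF open_U z smooth_R[OF H c]]) simp
        also have "\<dots> = 2 * \<tau> c k z"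
          using i[OF c z] unique[OF H w c z] by simp
        finally show ?thesis using dyR[OF c z] by simp
      qed
      moreover have "riemann_form A D (hamel_spray G Q) Q lam"
        using w hamel_part[OF H] unfolding scalar_curvature_def by blast
      ultimately show "riemann_form A D (hamel_spray G Q) Q lam \<and>
          (\<forall>c\<in>A. \<forall>z\<in>D c. \<forall>k. dy k (lam c) z = 0)" by blast
    next
      assume "riemann_form A D (hamel_spray G Q) Q lam \<and>
          (\<forall>c\<in>A. \<forall>z\<in>D c. \<forall>k. dy k (lam c) z = 0)"
      then show "isotropic_curvature A D (hamel_spray G Q)"
        unfolding isotropic_curvature_def using scalar[OF H] dyR by blast
    qed
    have fibre: "(\<forall>x y y'. connected_component {v. (x, v) \<in> D c} y y' \<longrightarrow>
        lam c (x, y) = lam c (x, y')) \<longleftrightarrow> (\<forall>z\<in>D c. \<forall>k. dy k (lam c) z = 0)" if "c \<in> A" for c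
    proof -
      interpret local_spray "D c" "G c" by (rule loc[OF that])
      show ?thesis by (rule fibre_constant_iff[OF smooth_lam[OF that]])
    qed
    have "depends_on_position A D (\<lambda>c z. ricci_scalar (G c) z / (Q c z)\<^sup>2 - 1 / 4) \<longleftrightarrow>
        depends_on_position A D lam"
    proof -
      have "ricci_scalar (G c) (x, y) / (Q c (x, y))\<^sup>2 - 1 / 4 = lam c (x, y) \<and>
          ricci_scalar (G c) (x, y') / (Q c (x, y'))\<^sup>2 - 1 / 4 = lam c (x, y')"
        if "c \<in> A" "connected_component {v. (x, v) \<in> D c} y y'" for c x y y'
        using connected_component_in[OF that(2)] lam_eq[OF that(1)] by simp
      then show ?thesis
        unfolding depends_on_position_def by (intro ball_cong refl all_cong1 imp_cong) simp
    qed
    also have "\<dots> \<longleftrightarrow> (\<forall>c\<in>A. \<forall>z\<in>D c. \<forall>k. dy k (lam c) z = 0)"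
      unfolding depends_on_position_def using fibre by blast
    finally have dep: "depends_on_position A D (\<lambda>c z. ricci_scalar (G c) z / (Q c z)\<^sup>2 - 1 / 4) \<longleftrightarrow>
        (\<forall>c\<in>A. \<forall>z\<in>D c. \<forall>k. dy k (lam c) z = 0)" .
    have "riemann_form A D (hamel_spray G Q) Q (\<lambda>c z. ricci_scalar (G c) z / (Q c z)\<^sup>2 - 1 / 4)
        \<longleftrightarrow> riemann_form A D (hamel_spray G Q) Q lam"
      unfolding riemann_form_def by (simp add: lam_eq)
    then show ?thesis using iso dep by simp
  qed
  show ?thesis
    using hamel_part[unfolded lam_def R_def P_def] funk_part by simp
qed

end
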